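(* Let $q=p^k$ with $p$ prime, let $F_q$ be the field with $q$ elements and let $R=M_n(F_q)$. Let $X=\{[A_i]\}$ be the set of all distinct equivalence classes of $\sim$ on $Z(R)$, let $X_2=\{[A_i]\in X : A_i\neq 0,\ A_i^2=0\}$ and let $Y_2$ be the set of classes in $X$ containing an idempotent matrix. Put $n_i=|[A_i]|$, $r_i=\mathrm{rank}(A_i)$, $l=|X_2|$, $m=|Y_2|$, let $d_i$ be the number of classes $[B]\in X$ with $A_iB=0$ or $BA_i=0$, and let $N_i=\sum_j n_j$, the sum being over all $j$ such that $[A_j]$ is adjacent to $[A_i]$ in $\Gamma(R)^{\sim}$. Then $$n_i=\prod_{k=0}^{r_i-1}(q^{r_i}-q^k),\qquad d_i=2\sum_{k=1}^{n-r_i}\binom{n-r_i}{k}_q\binom{n}{k}_q-\sum_{k=1}^{n-r_i}\binom{n-r_i}{k}_q^2,$$ $$m=\sum_{k=0}^{n}q^{k(n-k)}\binom{n}{k}_q-2,\qquad l=\sum_{k=1}^{\lfloor n/2\rfloor}\binom{n}{k}_q\binom{n-k}{k}_q,$$ and: (1) $\Gamma(R)$ is the $\Gamma(R)^{\sim}$-generalized join of the graphs $\overline{K}_{n_i}$ for $[A_i]\in X\setminus X_2$ and $K_{n_i}$ for $[A_i]\in X_2$, and $$\sigma_A(\Gamma(R))=\left(\bigcup_{[A_i]\in X_2}\{(-1)^{(n_i-1)}\}\right)\cup\left(\bigcup_{[A_i]\in X\setminus X_2}\{0^{(n_i-1)}\}\right)\cup\sigma(C_A),$$ where $C_A=(c_{ij})$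 is the square matrix indexed by $X$ with $c_{ii}=n_i-1$ if $[A_i]\in X_2$, $c_{ii}=0$ if $[A_i]\in X\setminus X_2$, and for $i\ne j$, $c_{ij}=\sqrt{n_in_j}$ if $[A_i]$ is adjacent to $[A_j]$ in $\Gamma(R)^{\sim}$ and $c_{ij}=0$ otherwise. (2) $$\sigma_L(\Gamma(R))=\left(\bigcup_{[A_i]\in X_2}\{(N_i+n_i)^{(n_i-1)}\}\right)\cup\left(\bigcup_{[A_i]\in X\setminus X_2}\{N_i^{(n_i-1)}\}\right)\cup\sigma(C_N),$$ where $C_N=(d_{ij})$ is the square matrix indexed by $X$ with $d_{ii}=N_i$ and for $i\neq j$, $d_{ij}=-\sqrt{n_in_j}$ if $[A_i]$ is adjacent to $[A_j]$ in $\Gamma(R)^{\sim}$ and $d_{ij}=0$ otherwise.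
   Context: $Z(R)$ is the set of nonzero zero-divisors of $R$ (nonzero $x$ with $xy=0$ or $yx=0$ for some nonzero $y$). $\Gamma(R)$ is the simple graph on $Z(R)$ with distinct $x,y$ adjacent iff $xy=0$ or $yx=0$. On $Z(R)$, $A\sim B$ iff $A=PB=BQ$ for some units (invertible matrices) $P,Q\in R$; this is an equivalence relation and $[A]$ is the class of $A$ (rank and the condition $A^2=0$ depend only on the class). $\Gamma(R)^{\sim}$ is the simple graph on the set of classes, distinct $[A],[B]$ being adjacent iff $AB=0$ or $BA=0$. $K_m$ is the complete graph and $\overline K_m$ the null (edgeless) graph on $m$ vertices. The $H$-generalized join of graphs $G_i$ indexed by the vertices of $H$ is obtained by replacing each vertex $i$ of $H$ by $G_i$ (vertex sets disjoint) and joining every vertex of $G_i$ to every vertex of $G_j$ whenever $i,j$ are adjacent in $H$. $\binom{n}{r}_q=\prod_{i=0}^{r-1}(q^n-q^i)/\prod_{i=0}^{r-1}(q^r-q^i)$ is the $q$-binomial coefficient, with $\binom{n}{r}_q=0$ if $r>n$ or $r<0$. $\sigma(M)$ is the multiset of eigenvalues of a matrix $M$; $\sigma_A(G)$, $\sigma_L(G)$ are the multisets of eigenvalues of the adjacency matrix $A(G)$ and of the Laplacian $L(G)=\mathrm{diag}(\text{degrees})-A(G)$. $\lambda^{(s)}$ means $\lambda$ with multiplicity $s$; unions are multiset unions (multiplicities add). *)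

theory Defs
  imports
    "HOL-Computational_Algebra.Primes"
    "HOL-Library.Cardinality"
    "Jordan_Normal_Form.Matrix"
    "Jordan_Normal_Form.Char_Poly"
    "Jordan_Normal_Form.DL_Rank"
    "Graph_Theory.Graph_Theory"
begin

section \<open>Zero-divisor graphs of rings\<close>

text \<open>Simple graphs are the symmetric loop-free pair digraphs of \<^theory>\<open>Graph_Theory.Pair_Digraph\<close>
  (locale \<^locale>\<open>pair_graph\<close> in the finite case): an undirected edge is a pair of opposite arcs.\<close>

definition zero_divisors :: "('r, 'm) ring_scheme \<Rightarrow> 'r set" where
  "zero_divisors R = {x \<in> carrier R. x \<noteq> \<zero>\<^bsub>R\<^esub> \<and>
     (\<exists>y \<in> carrier R. y \<noteq> \<zero>\<^bsub>R\<^esub> \<and> (x \<otimes>\<^bsub>R\<^esub> y = \<zero>\<^bsub>R\<^esub> \<or> y \<otimes>\<^bsub>R\<^esub> x = \<zero>\<^bsub>R\<^esub>))}"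

definition zero_divisor_graph :: "('r, 'm) ring_scheme \<Rightarrow> 'r pair_pre_digraph" where
  "zero_divisor_graph R = \<lparr>
     pverts = zero_divisors R,
     parcs = {(x, y). x \<in> zero_divisors R \<and> y \<in> zero_divisors R \<and> x \<noteq> y \<and>
                (x \<otimes>\<^bsub>R\<^esub> y = \<zero>\<^bsub>R\<^esub> \<or> y \<otimes>\<^bsub>R\<^esub> x = \<zero>\<^bsub>R\<^esub>)} \<rparr>"

definition unit_rel :: "('r, 'm) ring_scheme \<Rightarrow> 'r rel" where
  "unit_rel R = {(a, b). a \<in> zero_divisors R \<and> b \<in> zero_divisors R \<and>
     (\<exists>u \<in> Units R. \<exists>v \<in> Units R. a = u \<otimes>\<^bsub>R\<^esub> b \<and> a = b \<otimes>\<^bsub>R\<^esub> v)}"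

definition unit_class :: "('r, 'm) ring_scheme \<Rightarrow> 'r \<Rightarrow> 'r set" where
  "unit_class R a = unit_rel R `` {a}"

definition compressed_graph :: "('r, 'm) ring_scheme \<Rightarrow> 'r set pair_pre_digraph" where
  "compressed_graph R = \<lparr>
     pverts = zero_divisors R // unit_rel R,
     parcs = {(unit_class R a, unit_class R b) | a b.
                a \<in> zero_divisors R \<and> b \<in> zero_divisors R \<and> unit_class R a \<noteq> unit_class R b \<and>
                (a \<otimes>\<^bsub>R\<^esub> b = \<zero>\<^bsub>R\<^esub> \<or> b \<otimes>\<^bsub>R\<^esub> a = \<zero>\<^bsub>R\<^esub>)} \<rparr>"

lemma pair_graph_zero_divisor_graph:
  assumes "finite (carrier R)"
  shows "pair_graph (zero_divisor_graph R)"
proof -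
  have fin: "finite (zero_divisors R)"
    using assms by (auto simp: zero_divisors_def)
  have "parcs (zero_divisor_graph R) \<subseteq> zero_divisors R \<times> zero_divisors R"
    by (auto simp: zero_divisor_graph_def)
  with fin have "finite (parcs (zero_divisor_graph R))"
    by (meson finite_SigmaI finite_subset)
  with fin show ?thesis
    by unfold_locales
      (auto simp: zero_divisor_graph_def symmetric_def intro!: symI)
qed

section \<open>Generalized joins\<close>

definition complete_graph :: "nat \<Rightarrow> nat pair_pre_digraph" where
  "complete_graph m = \<lparr> pverts = {..<m}, parcs = {(u, v). u < m \<and> v < m \<and> u \<noteq> v} \<rparr>"

definition null_graph :: "nat \<Rightarrow> nat pair_pre_digraph" where
  "null_graph m = \<lparr> pverts = {..<m}, parcs = {} \<rparr>"

lemma complete_digraph_complete_graph: "K\<^bsub>m\<^esub> (with_proj (complete_graph m))"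
  unfolding complete_digraph_pair_def by (auto simp: complete_graph_def)

definition generalized_join ::
  "'i pair_pre_digraph \<Rightarrow> ('i \<Rightarrow> 'v pair_pre_digraph) \<Rightarrow> ('i \<times> 'v) pair_pre_digraph" where
  "generalized_join H G = \<lparr>
     pverts = (SIGMA i : pverts H. pverts (G i)),
     parcs = {((i, u), (j, v)) | i u j v.
                i \<in> pverts H \<and> j \<in> pverts H \<and> u \<in> pverts (G i) \<and> v \<in> pverts (G j) \<and>
                (i = j \<and> (u, v) \<in> parcs (G i) \<or> (i, j) \<in> parcs H)} \<rparr>"

section \<open>Spectra\<close>

text \<open>Roots of the characteristic polynomial over the complex numbers, i.e. the eigenvalues
  with their algebraic multiplicities.\<close>

definition eigenvalue_mset :: "complex mat \<Rightarrow> complex multiset" where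
  "eigenvalue_mset M = proots (char_poly M)"

text \<open>A matrix indexed by a finite set becomes a \<^typ>\<open>complex mat\<close> once the set is
  enumerated by a distinct list.\<close>

definition indexed_mat :: "'i list \<Rightarrow> ('i \<Rightarrow> 'i \<Rightarrow> complex) \<Rightarrow> complex mat" where
  "indexed_mat xs f = mat (length xs) (length xs) (\<lambda>(i, j). f (xs ! i) (xs ! j))"

definition adjacency_mat :: "'v pair_pre_digraph \<Rightarrow> 'v list \<Rightarrow> complex mat" where
  "adjacency_mat G vs = indexed_mat vs (\<lambda>u v. if (u, v) \<in> parcs G then 1 else 0)"

definition laplacian_mat :: "'v pair_pre_digraph \<Rightarrow> 'v list \<Rightarrow> complex mat" where
  "laplacian_mat G vs =
     indexed_mat vs (\<lambda>u v. if u = v then of_nat (out_degree (with_proj G) u) else 0)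
       - adjacency_mat G vs"

section \<open>Gaussian binomial coefficients\<close>

text \<open>For \<open>r > n\<close> the numerator contains the factor \<open>q ^ n - q ^ n\<close>, so the value is 0.\<close>

definition qbinomial :: "nat \<Rightarrow> nat \<Rightarrow> nat \<Rightarrow> real" where
  "qbinomial q n r =
     (\<Prod>i<r. real q ^ n - real q ^ i) / (\<Prod>i<r. real q ^ r - real q ^ i)"

end

theory Submission
  imports Defs "HOL-Library.Function_Algebras"
begin

text \<open>
  Two zero divisors of \<open>M\<^sub>n(F\<^sub>q)\<close> are equivalent iff they have the same image \<open>U\<close> and the same kernel \<open>W\<close>,
  so a class is a pair of subspaces with \<open>dim U + dim W = n\<close>, both nonzero. A member of the class
  is determined by the basis of \<open>U\<close> to which it sends a fixed basis of a complement of \<open>W\<close>.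
  Moreover \<open>AB = 0\<close> means \<open>im B \<subseteq> ker A\<close>, \<open>A\<^sup>2 = 0\<close> means \<open>U \<subseteq> W\<close>, and the class contains an idempotent iff
  \<open>U \<inter> W = 0\<close>. All class counts thus become counts of subspaces, which are obtained by counting the
  lists of vectors that extend a given independent set.

  Adjacency only depends on classes, so the adjacency matrix and the Laplacian both have entries
  \<open>\<delta>(u,v) a(C) + b(C,D)\<close> for \<open>u \<in> C\<close>, \<open>v \<in> D\<close>. Sylvester's identity \<open>det (1 - UV) = det (1 - VU)\<close> reduces
  their characteristic polynomials to the one of the matrix with entries
  \<open>\<delta>(C,D) a(C) + \<surd>(|C| |D|) b(C,D)\<close>, up to factors \<open>x - a(C)\<close>.
\<close>

section \<open>Counting subspaces over a finite field\<close>

text \<open>Two units appear in the relation because each side fixes one half of the pair: A = PB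
  preserves the kernel but may move the image, while A = BQ preserves the image but may move the
  kernel. The converse therefore needs two separate constructions of a unit. Vectors are functions
  on the naturals, a space of infinite dimension. Monotonicity of dimension, equality of nested
  subspaces and independence are thus obtained for finite subspaces, by comparing cardinalities
  through card T = q^(dim T). The form of the diagonal terms a(C) comes from the requirement that
  the remaining part b depend on classes only. In a clique class this forces b(C,C) = 1, which puts
  a loop at every vertex; a(C) = -1 removes it from the adjacency matrix. In the Laplacian the same
  correction raises the degree N_C + n_C - 1 to N_C + n_C. The square roots come from distributing
  the weight |C| evenly over the two factors in Sylvester's identity, which turns a symmetric b into
  a symmetric small matrix.\<close>

lemma finite_field_card_ge_2: "2 \<le> CARD('a::{field,finite})"
proof -
  have "card {0::'a, 1} \<le> CARD('a)" by (rule card_mono) auto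
  then show ?thesis by simp
qed

locale finite_field_vector_space = vector_space scale
  for scale :: "'a::{field,finite} \<Rightarrow> 'b::ab_group_add \<Rightarrow> 'b"
begin

text \<open>A further basis vector x multiplies the span by q: its elements are c x + y with y in
  the old span, and c and y are unique, since two expressions with different c would put x into the
  old span.\<close>

lemma card_span_independent:
  assumes "finite B" "independent B"
  shows "finite (span B) \<and> card (span B) = CARD('a) ^ card B"
  using assms
proof (induction B)
  case empty
  then show ?case by simp
next
  case (insert x B)
  have ind: "independent B" and x: "x \<notin> span B"
    using insert by (auto simp: independent_insert)
  let ?f = "\<lambda>(c, y). scale c x + y"
  have inj: "inj_on ?f (UNIV \<times> span B)"
  proof (rule inj_onI, clarify)
    fix c y c' y'
    assume y: "y \<in> span B" "y' \<in> span B" and eq: "scale c x + y = scale c' x + y'"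
    have "scale (c - c') x = y' - y"
      using eq by (simp add: scale_left_diff_distrib algebra_simps)
    then have s: "scale (c - c') x \<in> span B" using y by (simp add: span_diff)
    have "c = c'"
    proof (rule ccontr)
      assume "c \<noteq> c'"
      then have "scale (inverse (c - c')) (scale (c - c') x) = x" by simp
      then show False using x s span_scale by metis
    qed
    then show "c = c' \<and> y = y'" using eq by simp
  qed
  have "span (insert x B) = ?f ` (UNIV \<times> span B)"
  proof (intro Set.set_eqI iffI)
    fix z assume "z \<in> span (insert x B)"
    then obtain k where "z - scale k x \<in> span B" by (auto simp: span_insert)
    then show "z \<in> ?f ` (UNIV \<times> span B)"
      by (intro image_eqI[of _ _ "(k, z - scale k x)"]) auto
  next
    fix z assume "z \<in> ?f ` (UNIV \<times> span B)"
    then obtain c y where "z = scale c x + y" "y \<in> span B" by auto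
    then have "z - scale c x \<in> span B" by simp
    then show "z \<in> span (insert x B)" unfolding span_insert by blast
  qed
  with inj insert.IH[OF ind] insert.hyps show ?case
    by (simp add: card_image card_cartesian_product)
qed

lemma subspace_basis:
  assumes "subspace T" "finite T" "B0 \<subseteq> T" "independent B0"
  obtains B where "B0 \<subseteq> B" "B \<subseteq> T" "finite B" "independent B" "span B = T" "card B = dim T"
proof -
  obtain B where B: "B0 \<subseteq> B" "B \<subseteq> T" "independent B" "T \<subseteq> span B"
    using maximal_independent_subset_extend[of B0 T] assms by blast
  moreover have "span B = T" using B assms(1) by (simp add: span_minimal subset_antisym)
  moreover have "finite B" using B assms finite_subset by blast
  ultimately show ?thesis using that basis_card_eq_dim by blast
qed

lemma card_subspace:
  assumes "subspace T" "finite T"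
  shows "card T = CARD('a) ^ dim T"
  by (metis assms card_span_independent empty_subsetI independent_empty subspace_basis)

lemma power_card_inject [simp]: "CARD('a) ^ a = CARD('a) ^ b \<longleftrightarrow> a = b"
  using finite_field_card_ge_2[where 'a='a] by simp

lemma power_card_le [simp]: "CARD('a) ^ a \<le> CARD('a) ^ b \<longleftrightarrow> a \<le> b"
  using finite_field_card_ge_2[where 'a='a] by simp

lemma dim_mono_finite:
  assumes "subspace S" "subspace T" "finite T" "S \<subseteq> T"
  shows "dim S \<le> dim T"
  using card_mono[OF assms(3,4)] assms finite_subset[OF assms(4,3)] by (simp add: card_subspace)

lemma subspace_eq_of_dim:
  assumes "subspace S" "subspace T" "finite T" "S \<subseteq> T" "dim S = dim T"
  shows "S = T"
  using assms card_subset_eq[OF assms(3,4)] finite_subset[OF assms(4,3)]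
  by (simp add: card_subspace)

lemma dim_eq_0_finite:
  assumes "subspace S" "finite S"
  shows "dim S = 0 \<longleftrightarrow> S = {0}"
proof
  assume "dim S = 0"
  then have "card S = 1" using card_subspace[OF assms] by simp
  then show "S = {0}" using subspace_0[OF assms(1)] by (auto simp: card_1_singleton_iff)
next
  assume "S = {0}"
  then show "dim S = 0" using card_subspace[OF assms] power_card_inject[of 0 "dim S"]
    by (simp del: power_card_inject)
qed

text \<open>A maximal independent subset of S has the same span, hence by the count the same size as
  S, and a subset of full size is all of S.\<close>

lemma independent_if_card_span:
  assumes "finite S" "card (span S) = CARD('a) ^ card S"
  shows "independent S"
proof -
  obtain B where B: "B \<subseteq> S" "independent B" "S \<subseteq> span B"
    using maximal_independent_subset by blast
  have "span B = span S"
    using B by (metis span_mono span_span subset_antisym)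
  then have "card B = card S"
    using assms card_span_independent[of B] B finite_subset by (metis power_card_inject)
  then show ?thesis using B assms card_subset_eq by metis
qed

text \<open>Both sides express that addition is injective on \<open>span B \<times> span C\<close>.
  This domain has q^(card B + card C) elements and its image is \<open>span (B \<union> C)\<close>,
  so injectivity is a statement about the size of that span.\<close>

lemma independent_Un_iff:
  assumes "finite B" "finite C" "independent B" "independent C"
  shows "B \<inter> C = {} \<and> independent (B \<union> C) \<longleftrightarrow> span B \<inter> span C = {0}"
proof -
  let ?f = "\<lambda>(x, y). x + y"
  let ?P = "span B \<times> span C"
  have fin: "finite ?P" using assms by (simp add: card_span_independent)
  have card: "card ?P = CARD('a) ^ (card B + card C)"
    using assms by (simp add: card_cartesian_product card_span_independent power_add)
  have im: "span (B \<union> C) = ?f ` ?P" by (auto simp: span_Un)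
  show ?thesis
  proof
    assume L: "B \<inter> C = {} \<and> independent (B \<union> C)"
    then have "card (span (B \<union> C)) = CARD('a) ^ (card B + card C)"
      using assms by (simp add: card_span_independent card_Un_disjoint)
    then have inj: "inj_on ?f ?P"
      using eq_card_imp_inj_on[OF fin] im card by metis
    have "x = 0" if "x \<in> span B" "x \<in> span C" for x
      using inj_onD[OF inj, of "(x, 0)" "(0, x)"] that by (simp add: span_zero)
    then show "span B \<inter> span C = {0}" by (auto simp: span_zero)
  next
    assume R: "span B \<inter> span C = {0}"
    have disj: "B \<inter> C = {}"
      using R assms by (metis IntI Int_emptyI dependent_zero singletonD span_base)
    have "inj_on ?f ?P"
    proof (rule inj_onI, clarify)
      fix x y x' y'
      assume xy: "x \<in> span B" "y \<in> span C" "x' \<in> span B" "y' \<in> span C" and "x + y = x' + y'"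
      then have "x - x' = y' - y" by (simp add: algebra_simps)
      then have "x - x' \<in> span B \<inter> span C" using xy by (metis IntI span_diff)
      then have "x - x' = 0" using R by blast
      then show "x = x' \<and> y = y'" using \<open>x + y = x' + y'\<close> by simp
    qed
    then have "card (span (B \<union> C)) = CARD('a) ^ card (B \<union> C)"
      unfolding im using card card_image disj assms by (metis card_Un_disjoint)
    then show "B \<inter> C = {} \<and> independent (B \<union> C)"
      using disj assms independent_if_card_span by blast
  qed
qed

text \<open>Ordered lists can be counted by choosing one vector at a time, which is impossible for
  bases as sets. Disjointness from \<open>B\<close> is demanded separately because a repeated vector
  would disappear in the union. For empty \<open>B\<close> and \<open>k = dim T\<close> these are
  the ordered bases of \<open>T\<close>.\<close>

definition extensions :: "'b set \<Rightarrow> 'b set \<Rightarrow> nat \<Rightarrow> 'b list set" where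
  "extensions B T k = {xs. length xs = k \<and> distinct xs \<and> set xs \<subseteq> T \<and> set xs \<inter> B = {} \<and>
     independent (B \<union> set xs)}"

text \<open>Once i vectors are chosen, the next one is any element of T outside a span of q^(card B
  + i) elements. The formula stays correct for k too large: then one factor of the product is
  zero.\<close>

lemma card_extensions:
  assumes "subspace T" "finite T" "B \<subseteq> T" "independent B"
  shows "finite (extensions B T k) \<and>
    real (card (extensions B T k)) = (\<Prod>i<k. real CARD('a) ^ dim T - real CARD('a) ^ (card B + i))"
proof (induction k)
  case 0
  have "extensions B T 0 = {[]}" using assms by (auto simp: extensions_def)
  then show ?case by simp
next
  case (Suc k)
  let ?S = "SIGMA xs : extensions B T k. T - span (B \<union> set xs)"
  have "extensions B T (Suc k) = (\<lambda>(xs, x). x # xs) ` ?S"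
  proof (intro Set.set_eqI iffI)
    fix ys assume ys: "ys \<in> extensions B T (Suc k)"
    then obtain x xs where eq: "ys = x # xs" by (cases ys) (auto simp: extensions_def)
    have "x \<notin> B \<union> set xs" "independent (insert x (B \<union> set xs))"
      using ys eq by (auto simp: extensions_def)
    then have "x \<notin> span (B \<union> set xs)" "independent (B \<union> set xs)"
      by (auto simp: independent_insert)
    then show "ys \<in> (\<lambda>(xs, x). x # xs) ` ?S"
      using ys eq by (auto simp: extensions_def)
  next
    fix ys assume "ys \<in> (\<lambda>(xs, x). x # xs) ` ?S"
    then obtain x xs where *: "ys = x # xs" "xs \<in> extensions B T k" "x \<in> T"
        "x \<notin> span (B \<union> set xs)"
      by auto
    then have "x \<notin> B \<union> set xs" using span_base by blast
    with * show "ys \<in> extensions B T (Suc k)"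
      by (auto simp: extensions_def independent_insert)
  qed
  moreover have "inj_on (\<lambda>(xs, x). x # xs) ?S" by (auto simp: inj_on_def)
  moreover have fS: "finite ?S" using Suc assms by auto
  moreover have "real (card (T - span (B \<union> set xs))) = real CARD('a) ^ dim T - real CARD('a) ^ (card B + k)"
    if xs: "xs \<in> extensions B T k" for xs
  proof -
    have fin: "finite B" using assms finite_subset by blast
    have sub: "span (B \<union> set xs) \<subseteq> T"
      using xs assms by (intro span_minimal) (auto simp: extensions_def)
    have "card (B \<union> set xs) = card B + k"
      using xs fin by (subst card_Un_disjoint) (auto simp: extensions_def distinct_card)
    then have c: "card (span (B \<union> set xs)) = CARD('a) ^ (card B + k)"
      using xs fin card_span_independent[of "B \<union> set xs"] by (simp add: extensions_def)
    have "card (T - span (B \<union> set xs)) = card T - CARD('a) ^ (card B + k)"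
      using c sub assms by (simp add: card_Diff_subset finite_subset)
    moreover have "CARD('a) ^ (card B + k) \<le> card T"
      using c sub assms card_mono by metis
    ultimately show ?thesis using card_subspace[OF assms(1,2)] by (simp add: of_nat_diff)
  qed
  ultimately show ?case
    using Suc assms by (simp add: card_image card_SigmaI)
qed

text \<open>The span with \<open>B\<close> is the subspace under which a list is filed in the double
  counts below; the last fact says that the list is also counted inside that subspace.\<close>

lemma extensions_span:
  assumes "subspace T" "finite T" "B \<subseteq> T" "xs \<in> extensions B T k"
  shows "subspace (span (B \<union> set xs))" "span (B \<union> set xs) \<subseteq> T"
    "dim (span (B \<union> set xs)) = card B + k"
    "xs \<in> extensions B (span (B \<union> set xs)) k"
proof -
  have "finite B" using assms finite_subset by blast
  then have "card (B \<union> set xs) = card B + k"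
    using assms by (subst card_Un_disjoint) (auto simp: extensions_def distinct_card)
  then show "dim (span (B \<union> set xs)) = card B + k"
    using assms by (simp add: dim_eq_card_independent extensions_def del: dim_span add: dim_span_eq_card_independent)
  show "span (B \<union> set xs) \<subseteq> T"
    using assms by (intro span_minimal) (auto simp: extensions_def)
  show "xs \<in> extensions B (span (B \<union> set xs)) k"
    using assms span_superset[of "B \<union> set xs"] by (auto simp: extensions_def)
qed simp

text \<open>Double counting of the lists that extend a basis B of U inside T. Each list belongs to
  exactly one W, its span with B, and every W receives equally many lists. Cancelling q^(dim U) in
  all factors of the quotient leaves the q-binomial.\<close>

lemma card_subspaces_between:
  assumes "subspace U" "subspace T" "finite T" "U \<subseteq> T"
  shows "real (card {W. subspace W \<and> U \<subseteq> W \<and> W \<subseteq> T \<and> dim W = dim U + k})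
    = qbinomial CARD('a) (dim T - dim U) k"
proof -
  let ?S = "{W. subspace W \<and> U \<subseteq> W \<and> W \<subseteq> T \<and> dim W = dim U + k}"
  have finU: "finite U" using assms finite_subset by blast
  obtain B where B: "B \<subseteq> U" "finite B" "independent B" "span B = U" "card B = dim U"
    using subspace_basis[OF assms(1) finU empty_subsetI independent_empty] by metis
  have BT: "B \<subseteq> T" using B assms by blast
  have finS: "finite ?S" using assms(3) by (rule finite_subset[rotated, OF finite_Pow_iff[THEN iffD2]]) auto
  \<comment> \<open>\<open>W\<close> can be recovered from the list, so the sets of lists belonging
    to different \<open>W\<close> are disjoint.\<close>
  have sp: "W = span (B \<union> set xs)" if "W \<in> ?S" "xs \<in> extensions B W k" for W xs
  proof -
    have "finite W" "B \<subseteq> W" using that assms(3) finite_subset B by auto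
    then show ?thesis
      using that B extensions_span[of W B xs k] subspace_eq_of_dim[of "span (B \<union> set xs)" W] by auto
  qed
  have "extensions B T k = (\<Union>W\<in>?S. extensions B W k)"
  proof (intro Set.set_eqI iffI)
    fix xs assume xs: "xs \<in> extensions B T k"
    have "U \<subseteq> span (B \<union> set xs)" using B span_mono by blast
    then have "span (B \<union> set xs) \<in> ?S"
      using extensions_span[OF assms(2,3) BT xs] B by auto
    then show "xs \<in> (\<Union>W\<in>?S. extensions B W k)"
      using extensions_span(4)[OF assms(2,3) BT xs] by blast
  qed (auto simp: extensions_def)
  moreover have "card (\<Union>W\<in>?S. extensions B W k) = (\<Sum>W\<in>?S. card (extensions B W k))"
  proof (rule card_UN_disjoint[OF finS])
    show "\<forall>W\<in>?S. finite (extensions B W k)"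
      using card_extensions B assms(3) finite_subset by (metis (mono_tags, lifting) mem_Collect_eq subset_trans)
    show "\<forall>W\<in>?S. \<forall>W'\<in>?S. W \<noteq> W' \<longrightarrow> extensions B W k \<inter> extensions B W' k = {}"
      using sp by blast
  qed
  moreover have "real (card (extensions B W k)) = (\<Prod>i<k. real CARD('a) ^ (dim U + k) - real CARD('a) ^ (dim U + i))"
    if "W \<in> ?S" for W
    using that card_extensions[of W B k] B assms(3) finite_subset[of W T] by auto
  ultimately have "real (card (extensions B T k)) =
      real (card ?S) * (\<Prod>i<k. real CARD('a) ^ (dim U + k) - real CARD('a) ^ (dim U + i))"
    by simp
  moreover have "real (card (extensions B T k)) = (\<Prod>i<k. real CARD('a) ^ dim T - real CARD('a) ^ (dim U + i))"
    using card_extensions[OF assms(2,3) BT B(3), of k] B by simp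
  moreover have "(\<Prod>i<k. real CARD('a) ^ (dim U + k) - real CARD('a) ^ (dim U + i)) \<noteq> 0"
    using finite_field_card_ge_2[where 'a='a] by (auto simp: power_add)
  moreover have "dim U \<le> dim T" using dim_mono_finite assms by blast
  then have "real CARD('a) ^ dim T = real CARD('a) ^ dim U * real CARD('a) ^ (dim T - dim U)"
    by (simp flip: power_add)
  ultimately have "real (card ?S) = (\<Prod>i<k. real CARD('a) ^ dim U * (real CARD('a) ^ (dim T - dim U) - real CARD('a) ^ i))
      / (\<Prod>i<k. real CARD('a) ^ dim U * (real CARD('a) ^ k - real CARD('a) ^ i))"
    by (simp add: power_add right_diff_distrib field_simps)
  also have "\<dots> = qbinomial CARD('a) (dim T - dim U) k"
    using finite_field_card_ge_2[where 'a='a] by (simp add: qbinomial_def prod.distrib)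
  finally show ?thesis .
qed

text \<open>A list extends a basis of U to one of T exactly when it is an ordered basis of a
  complement W. Compared with the number of ordered bases of a single W, the number of all these
  lists has an additional factor q^(dim U) at each of the k positions.\<close>

lemma card_complements:
  assumes "subspace U" "subspace T" "finite T" "U \<subseteq> T" "dim T = dim U + k"
  shows "real (card {W. subspace W \<and> W \<subseteq> T \<and> dim W = k \<and> U \<inter> W = {0}}) = real CARD('a) ^ (dim U * k)"
proof -
  let ?S = "{W. subspace W \<and> W \<subseteq> T \<and> dim W = k \<and> U \<inter> W = {0}}"
  have finU: "finite U" using assms finite_subset by blast
  obtain B where B: "B \<subseteq> U" "finite B" "independent B" "span B = U" "card B = dim U"
    using subspace_basis[OF assms(1) finU empty_subsetI independent_empty] by metis
  have BT: "B \<subseteq> T" using B assms by blast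
  have finS: "finite ?S" using assms(3) by (rule finite_subset[rotated, OF finite_Pow_iff[THEN iffD2]]) auto
  have sp: "W = span (set xs)" if "W \<in> ?S" "xs \<in> extensions {} W k" for W xs
    using that assms(3) finite_subset[of W T] extensions_span[of W "{}" xs k]
      subspace_eq_of_dim[of "span (set xs)" W] by auto
  have "extensions B T k = (\<Union>W\<in>?S. extensions {} W k)"
  proof (intro Set.set_eqI iffI)
    fix xs assume xs: "xs \<in> extensions B T k"
    then have ind: "independent (set xs)" "B \<inter> set xs = {} \<and> independent (B \<union> set xs)"
      using independent_mono[of "B \<union> set xs"] by (auto simp: extensions_def)
    then have xs': "xs \<in> extensions {} T k" using xs by (auto simp: extensions_def)
    have "U \<inter> span (set xs) = {0}"
      using independent_Un_iff[of B "set xs"] ind B by simp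
    then have "span (set xs) \<in> ?S"
      using extensions_span[OF assms(2,3) _ xs'] by auto
    then show "xs \<in> (\<Union>W\<in>?S. extensions {} W k)"
      using extensions_span(4)[OF assms(2,3) _ xs'] by auto
  next
    fix xs assume "xs \<in> (\<Union>W\<in>?S. extensions {} W k)"
    then obtain W where W: "W \<in> ?S" "xs \<in> extensions {} W k" by blast
    have "span B \<inter> span (set xs) = {0}" using sp[OF W] W B by auto
    then have "B \<inter> set xs = {} \<and> independent (B \<union> set xs)"
      using independent_Un_iff[of B "set xs"] B W by (auto simp: extensions_def)
    then show "xs \<in> extensions B T k" using W by (auto simp: extensions_def)
  qed
  moreover have "card (\<Union>W\<in>?S. extensions {} W k) = (\<Sum>W\<in>?S. card (extensions {} W k))"
  proof (rule card_UN_disjoint[OF finS])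
    show "\<forall>W\<in>?S. finite (extensions {} W k)"
    proof
      fix W assume W: "W \<in> ?S"
      then have "finite W" using assms(3) finite_subset by blast
      then show "finite (extensions {} W k)" using W card_extensions[of W "{}" k] independent_empty by auto
    qed
    show "\<forall>W\<in>?S. \<forall>W'\<in>?S. W \<noteq> W' \<longrightarrow> extensions {} W k \<inter> extensions {} W' k = {}"
      using sp by (metis (no_types, lifting) Int_emptyI)
  qed
  moreover have "real (card (extensions {} W k)) = (\<Prod>i<k. real CARD('a) ^ k - real CARD('a) ^ i)"
    if "W \<in> ?S" for W
    using that card_extensions[of W "{}" k] assms(3) finite_subset[of W T] independent_empty by auto
  ultimately have "real (card (extensions B T k)) =
      real (card ?S) * (\<Prod>i<k. real CARD('a) ^ k - real CARD('a) ^ i)"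
    by simp
  moreover have "real (card (extensions B T k)) = (\<Prod>i<k. real CARD('a) ^ dim U * (real CARD('a) ^ k - real CARD('a) ^ i))"
    using card_extensions[OF assms(2,3) BT B(3), of k] B assms(5) by (simp add: power_add right_diff_distrib)
  moreover have "(\<Prod>i<k. real CARD('a) ^ k - real CARD('a) ^ i) \<noteq> 0"
    using finite_field_card_ge_2[where 'a='a] by auto
  ultimately show ?thesis by (simp add: prod.distrib power_mult)
qed

end

text \<open>For a prime power q, the auxiliary \<open>f m\<close> is the order of GL_m(F_q).
  Splitting the product for \<open>f n\<close> after j factors writes the q-binomial as f n / (f j *
  q^(j(n-j)) * f (n-j)), which is invariant under exchanging j and n - j.\<close>

lemma qbinomial_symmetric:
  assumes "k \<le> n" "2 \<le> q"
  shows "qbinomial q n (n - k) = qbinomial q n k"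
proof -
  define f where "f m = (\<Prod>i<m. real q ^ m - real q ^ i)" for m
  have f0: "f m \<noteq> 0" for m using assms by (auto simp: f_def)
  have num: "(\<Prod>i<j. real q ^ n - real q ^ i) * (real q ^ (j * (n - j)) * f (n - j)) = f n"
    if "j \<le> n" for j
  proof -
    have "f n = (\<Prod>i<j. real q ^ n - real q ^ i) * (\<Prod>i=j..<n. real q ^ n - real q ^ i)"
      using that by (simp add: f_def lessThan_atLeast0 prod.atLeastLessThan_concat)
    also have "(\<Prod>i=j..<n. real q ^ n - real q ^ i) = (\<Prod>i<n - j. real q ^ n - real q ^ (i + j))"
      using that by (intro prod.reindex_bij_witness[of _ "\<lambda>i. i + j" "\<lambda>i. i - j"]) auto
    also have "\<dots> = (\<Prod>i<n - j. real q ^ j * (real q ^ (n - j) - real q ^ i))"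
      using that by (intro prod.cong) (auto simp: right_diff_distrib algebra_simps simp flip: power_add)
    also have "\<dots> = real q ^ (j * (n - j)) * f (n - j)"
      by (simp add: prod.distrib f_def power_mult)
    finally show ?thesis ..
  qed
  have *: "qbinomial q n j = f n / (f j * (real q ^ (j * (n - j)) * f (n - j)))" if "j \<le> n" for j
    using num[OF that] f0[of "n - j"] f0[of j] assms
    by (simp add: qbinomial_def f_def[of j] field_simps)
  show ?thesis using assms by (subst (1 2) *) (auto simp: mult.commute)
qed

section \<open>Spectra of blown-up matrices\<close>

text \<open>The block matrix \<open>?L\<close> is multiplied by the unipotent \<open>?E\<close> from
  either side. Both products are block upper triangular, with 1 - UV as the only nontrivial diagonal
  block of one and 1 - VU of the other, and their determinants agree.\<close>

lemma det_one_minus_mult_commute: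
  fixes U V :: "'a::idom mat"
  assumes U: "U \<in> carrier_mat m n" and V: "V \<in> carrier_mat n m"
  shows "det (1\<^sub>m m - U * V) = det (1\<^sub>m n - V * U)"
proof -
  let ?L = "four_block_mat (1\<^sub>m m) U V (1\<^sub>m n)"
  let ?E = "four_block_mat (1\<^sub>m m) (0\<^sub>m m n) (- V) (1\<^sub>m n)"
  have L: "?L \<in> carrier_mat (m + n) (m + n)" and E: "?E \<in> carrier_mat (m + n) (m + n)"
    by auto
  have E1: "det ?E = 1"
    using V by (subst det_four_block_mat_upper_right_zero) auto
  have LE: "?L * ?E = four_block_mat (1\<^sub>m m - U * V) U (0\<^sub>m n m) (1\<^sub>m n)"
    using U V
    by (subst mult_four_block_mat[of _ m m _ n _ n _ _ m _ n])
       (auto intro!: cong_four_block_mat simp: minus_add_uminus_mat[of _ m m] uminus_mult_right_mat)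
  have EL: "?E * ?L = four_block_mat (1\<^sub>m m) U (0\<^sub>m n m) (1\<^sub>m n - V * U)"
    using U V
    by (subst mult_four_block_mat[of _ m m _ n _ n _ _ m _ n])
       (auto intro!: cong_four_block_mat)
  have "det (1\<^sub>m m - U * V) = det (?L * ?E)"
    unfolding LE using U V by (subst det_four_block_mat_lower_left_zero) auto
  also have "\<dots> = det (?E * ?L)" using det_mult[OF L E] det_mult[OF E L] by (simp add: mult.commute)
  also have "\<dots> = det (1\<^sub>m n - V * U)"
    unfolding EL using U V by (subst det_four_block_mat_lower_left_zero) auto
  finally show ?thesis .
qed

lemma poly_char_poly:
  assumes "A \<in> carrier_mat n n"
  shows "poly (char_poly A) x = det (mat n n (\<lambda>(i, j). (if i = j then x else 0) - A $$ (i, j)))"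
proof -
  have "poly (char_poly A) x = det (map_mat (\<lambda>p. poly p x) (char_poly_matrix A))"
    by (simp add: char_poly_def comm_ring_hom.hom_det[OF poly_hom.comm_ring_hom_axioms])
  also have "map_mat (\<lambda>p. poly p x) (char_poly_matrix A) =
      mat n n (\<lambda>(i, j). (if i = j then x else 0) - A $$ (i, j))"
    using assms by (intro eq_matI) (auto simp: char_poly_matrix_def)
  finally show ?thesis .
qed

lemma det_diag:
  "det (mat n n (\<lambda>(i, j). if i = j then d i else (0::'a::comm_ring_1))) = (\<Prod>i<n. d i)"
  by (subst det_upper_triangular[of _ n])
     (auto simp: upper_triangular_def diag_mat_def prod.list_conv_set_nth lessThan_atLeast0 intro!: prod.cong)

text \<open>With D the diagonal matrix of d and M = D U V, the difference D - M is D (1 - U V), and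
  Sylvester's identity passes to the size of V U.\<close>

lemma det_diag_minus:
  fixes d :: "nat \<Rightarrow> 'a::field"
  assumes U: "U \<in> carrier_mat m n" and V: "V \<in> carrier_mat n m"
    and M: "\<And>i j. i < m \<Longrightarrow> j < m \<Longrightarrow> M i j = d i * (U * V) $$ (i, j)"
  shows "det (mat m m (\<lambda>(i, j). (if i = j then d i else 0) - M i j))
    = (\<Prod>i<m. d i) * det (1\<^sub>m n - V * U)"
proof -
  let ?D = "mat m m (\<lambda>(i, j). if i = j then d i else 0)"
  have "mat m m (\<lambda>(i, j). (if i = j then d i else 0) - M i j) = ?D * (1\<^sub>m m - U * V)"
  proof (rule eq_matI)
    fix i j assume "i < dim_row (?D * (1\<^sub>m m - U * V))" "j < dim_col (?D * (1\<^sub>m m - U * V))"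
    then have ij: "i < m" "j < m" using V by auto
    have "(?D * (1\<^sub>m m - U * V)) $$ (i, j) = (\<Sum>k<m. (if i = k then d i else 0) * (1\<^sub>m m - U * V) $$ (k, j))"
      using ij U V by (auto simp: scalar_prod_def lessThan_atLeast0 intro!: sum.cong)
    also have "\<dots> = d i * (1\<^sub>m m - U * V) $$ (i, j)"
      using ij by (simp add: if_distrib[of "\<lambda>x. x * _"] cong: if_cong)
    also have "\<dots> = (if i = j then d i else 0) - M i j"
      using ij U V by (simp add: M right_diff_distrib del: index_mult_mat(1))
    finally show "mat m m (\<lambda>(i, j). (if i = j then d i else 0) - M i j) $$ (i, j) = (?D * (1\<^sub>m m - U * V)) $$ (i, j)"
      using ij by simp
  qed (use U V in auto)
  moreover have "det (?D * (1\<^sub>m m - U * V)) = det ?D * det (1\<^sub>m m - U * V)"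
    using U V by (intro det_mult) auto
  ultimately show ?thesis by (simp add: det_diag det_one_minus_mult_commute[OF U V])
qed

lemma sum_nth_distinct:
  assumes "distinct xs"
  shows "(\<Sum>i<length xs. g (xs ! i)) = sum g (set xs)"
  using sum.reindex_bij_betw[OF bij_betw_nth[OF assms refl refl]] by simp

lemma prod_nth_distinct:
  assumes "distinct xs"
  shows "(\<Prod>i<length xs. g (xs ! i)) = prod g (set xs)"
  using prod.reindex_bij_betw[OF bij_betw_nth[OF assms refl refl]] by simp

text \<open>For \<open>x \<noteq> a C\<close> both determinants \<open>det (x - M)\<close> reduce, by Sylvester's identity, to the same
  determinant of size \<open>card (set cs)\<close>; the two polynomials therefore agree.\<close>

lemma char_poly_blowup:
  fixes a :: "'i \<Rightarrow> complex" and b :: "'i \<Rightarrow> 'i \<Rightarrow> complex" and f :: "'v \<Rightarrow> 'i"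
  assumes vs: "distinct vs" and cs: "distinct cs" "set cs = f ` set vs"
  defines "n \<equiv> \<lambda>C. card {v \<in> set vs. f v = C}"
  shows "char_poly (indexed_mat vs (\<lambda>u v. (if u = v then a (f u) else 0) + b (f u) (f v)))
    = (\<Prod>C\<in>set cs. [:- a C, 1:] ^ (n C - 1)) *
      char_poly (indexed_mat cs (\<lambda>C D. (if C = D then a C else 0) +
        complex_of_real (sqrt (real (n C) * real (n D))) * b C D))"
    (is "char_poly (indexed_mat vs ?M) = ?p * char_poly (indexed_mat cs ?K)")
proof -
  let ?m = "length vs" and ?k = "length cs"
  let ?s = "\<lambda>C. complex_of_real (sqrt (real (n C)))"
  have n0: "n C > 0" if "C \<in> set cs" for C
    using that cs by (auto simp: n_def card_gt_0_iff)
  have f_in: "f (vs ! i) \<in> set cs" if "i < ?m" for i using that cs by auto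
  have ss: "?s C * ?s C = of_nat (n C)" for C
    by (simp flip: of_real_mult)
  have eq: "poly (char_poly (indexed_mat vs ?M)) x = poly (?p * char_poly (indexed_mat cs ?K)) x"
    if x: "x \<notin> a ` set cs" for x
  proof -
    have xa: "x - a C \<noteq> 0" if "C \<in> set cs" for C using x that by auto
    \<comment> \<open>\<open>U\<close> sends a vertex to its class and divides by the diagonal entry
      there; \<open>V\<close> reads b off the classes. Multiplying \<open>U * V\<close> by the
      diagonal entries thus gives back the class-dependent part b.\<close>
    define U where "U = mat ?m ?k (\<lambda>(i, l). if f (vs ! i) = cs ! l then inverse (x - a (cs ! l)) else 0)"
    define V where "V = mat ?k ?m (\<lambda>(l, j). b (cs ! l) (f (vs ! j)))"
    \<comment> \<open>The weight is split as a square root on each side: \<open>U' * V'\<close> then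
      carries \<surd>(n C) \<surd>(n D), while in \<open>V' * U'\<close> both roots meet at the same
      class and give n D, the number of vertices over which \<open>V * U\<close> sums.\<close>
    define U' where "U' = mat ?k ?k (\<lambda>(i, l). if i = l then ?s (cs ! i) * inverse (x - a (cs ! i)) else 0)"
    define V' where "V' = mat ?k ?k (\<lambda>(i, l). b (cs ! i) (cs ! l) * ?s (cs ! l))"
    have c: "U \<in> carrier_mat ?m ?k" "V \<in> carrier_mat ?k ?m" "U' \<in> carrier_mat ?k ?k" "V' \<in> carrier_mat ?k ?k"
      by (auto simp: U_def V_def U'_def V'_def)
    have UV: "(U * V) $$ (i, j) = inverse (x - a (f (vs ! i))) * b (f (vs ! i)) (f (vs ! j))"
      if ij: "i < ?m" "j < ?m" for i j
    proof -
      have "(U * V) $$ (i, j) = (\<Sum>l<?k. (\<lambda>C. if f (vs ! i) = C then inverse (x - a C) * b C (f (vs ! j)) else 0) (cs ! l))"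
        using ij by (auto simp: U_def V_def scalar_prod_def lessThan_atLeast0 intro!: sum.cong)
      also have "\<dots> = (\<Sum>C\<in>set cs. if f (vs ! i) = C then inverse (x - a C) * b C (f (vs ! j)) else 0)"
        by (rule sum_nth_distinct[OF cs(1)])
      finally show ?thesis using f_in[OF ij(1)] by simp
    qed
    have UV': "(U' * V') $$ (i, j) = inverse (x - a (cs ! i)) * (?s (cs ! i) * ?s (cs ! j) * b (cs ! i) (cs ! j))"
      if ij: "i < ?k" "j < ?k" for i j
    proof -
      have "(U' * V') $$ (i, j) = (\<Sum>l<?k. (if i = l then ?s (cs ! i) * inverse (x - a (cs ! i)) else 0) *
          (b (cs ! l) (cs ! j) * ?s (cs ! j)))"
        using ij by (auto simp: U'_def V'_def scalar_prod_def lessThan_atLeast0 intro!: sum.cong)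
      then show ?thesis
        using ij by (simp add: if_distrib[of "\<lambda>t. t * _"] cong: if_cong)
    qed
    have dUV: "b (f (vs ! i)) (f (vs ! j)) = (x - a (f (vs ! i))) * (U * V) $$ (i, j)"
      if ij: "i < ?m" "j < ?m" for i j
      unfolding UV[OF ij] mult.assoc[symmetric] right_inverse[OF xa[OF f_in[OF ij(1)]]] by simp
    have dUV': "?s (cs ! i) * ?s (cs ! j) * b (cs ! i) (cs ! j) = (x - a (cs ! i)) * (U' * V') $$ (i, j)"
      if ij: "i < ?k" "j < ?k" for i j
      unfolding UV'[OF ij] mult.assoc[symmetric] right_inverse[OF xa[OF nth_mem[OF ij(1)]]] by simp
    have VU: "V * U = V' * U'"
    proof (rule eq_matI)
      fix i j assume "i < dim_row (V' * U')" "j < dim_col (V' * U')"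
      then have ij: "i < ?k" "j < ?k" by (auto simp: U'_def V'_def)
      have "(V * U) $$ (i, j) = (\<Sum>l<?m. (\<lambda>v. if f v = cs ! j then b (cs ! i) (cs ! j) * inverse (x - a (cs ! j)) else 0) (vs ! l))"
        using ij by (auto simp: U_def V_def scalar_prod_def lessThan_atLeast0 intro!: sum.cong)
      also have "\<dots> = (\<Sum>v\<in>set vs. if f v = cs ! j then b (cs ! i) (cs ! j) * inverse (x - a (cs ! j)) else 0)"
        by (rule sum_nth_distinct[OF vs])
      also have "\<dots> = of_nat (n (cs ! j)) * (b (cs ! i) (cs ! j) * inverse (x - a (cs ! j)))"
        by (simp add: n_def flip: sum.inter_filter)
      also have "\<dots> = (V' * U') $$ (i, j)"
      proof -
        have "(V' * U') $$ (i, j) = (\<Sum>l<?k. b (cs ! i) (cs ! l) * ?s (cs ! l) *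
            (if l = j then ?s (cs ! l) * inverse (x - a (cs ! l)) else 0))"
          using ij by (auto simp: U'_def V'_def scalar_prod_def lessThan_atLeast0 intro!: sum.cong)
        also have "\<dots> = b (cs ! i) (cs ! j) * (?s (cs ! j) * ?s (cs ! j)) * inverse (x - a (cs ! j))"
          using ij by (simp add: if_distrib[of "\<lambda>t. _ * t"] cong: if_cong)
        finally show ?thesis by (simp add: ss)
      qed
      finally show "(V * U) $$ (i, j) = (V' * U') $$ (i, j)" .
    qed (auto simp: U_def V_def U'_def V'_def)
    have "poly (char_poly (indexed_mat vs ?M)) x
        = det (mat ?m ?m (\<lambda>(i, j). (if i = j then x - a (f (vs ! i)) else 0) - b (f (vs ! i)) (f (vs ! j))))"
      by (subst poly_char_poly[of _ ?m])
         (auto simp: indexed_mat_def nth_eq_iff_index_eq[OF vs] intro!: arg_cong[of _ _ det] eq_matI)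
    also have "\<dots> = (\<Prod>i<?m. x - a (f (vs ! i))) * det (1\<^sub>m ?k - V * U)"
      by (rule det_diag_minus[OF c(1,2)]) (simp only: dUV)
    also have "(\<Prod>i<?m. x - a (f (vs ! i))) = (\<Prod>v\<in>set vs. x - a (f v))"
      by (rule prod_nth_distinct[OF vs])
    also have "\<dots> = (\<Prod>C\<in>set cs. (x - a C) ^ n C)"
      using cs by (subst prod.group[symmetric, of _ "set cs" f]) (auto simp: n_def intro!: prod.cong)
    \<comment> \<open>One factor per class goes to the small determinant. Every class contains a
      vertex, so n C is positive and the exponent n C - 1 is a true difference.\<close>
    also have "\<dots> = (\<Prod>C\<in>set cs. (x - a C) ^ (n C - 1)) * (\<Prod>C\<in>set cs. x - a C)"
      unfolding prod.distrib[symmetric] using n0 by (intro prod.cong refl power_minus_mult[symmetric]) auto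
    also have "(\<Prod>C\<in>set cs. x - a C) = (\<Prod>i<?k. x - a (cs ! i))"
      by (rule prod_nth_distinct[OF cs(1), symmetric])
    also have "(\<Prod>C\<in>set cs. (x - a C) ^ (n C - 1)) * (\<Prod>i<?k. x - a (cs ! i)) * det (1\<^sub>m ?k - V * U)
        = (\<Prod>C\<in>set cs. (x - a C) ^ (n C - 1)) * ((\<Prod>i<?k. x - a (cs ! i)) * det (1\<^sub>m ?k - V' * U'))"
      by (simp add: VU)
    also have "(\<Prod>i<?k. x - a (cs ! i)) * det (1\<^sub>m ?k - V' * U')
        = det (mat ?k ?k (\<lambda>(i, j). (if i = j then x - a (cs ! i) else 0) - ?s (cs ! i) * ?s (cs ! j) * b (cs ! i) (cs ! j)))"
      by (rule det_diag_minus[OF c(3,4), symmetric]) (simp only: dUV')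
    also have "\<dots> = poly (char_poly (indexed_mat cs ?K)) x"
      by (subst poly_char_poly[of _ ?k])
         (auto simp: indexed_mat_def nth_eq_iff_index_eq[OF cs(1)] real_sqrt_mult intro!: arg_cong[of _ _ det] eq_matI)
    also have "(\<Prod>C\<in>set cs. (x - a C) ^ (n C - 1)) = poly ?p x"
      by (simp add: poly_prod)
    finally show ?thesis by simp
  qed
  \<comment> \<open>Only the finitely many values of a were excluded, so the difference of the two
    polynomials has infinitely many roots.\<close>
  have "infinite (UNIV - a ` set cs)"
    by (intro Diff_infinite_finite) (auto simp: infinite_UNIV_char_0)
  moreover have "UNIV - a ` set cs \<subseteq>
      {x. poly (char_poly (indexed_mat vs ?M) - ?p * char_poly (indexed_mat cs ?K)) x = 0}"
    using eq by auto
  ultimately have "infinite {x. poly (char_poly (indexed_mat vs ?M) - ?p * char_poly (indexed_mat cs ?K)) x = 0}"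
    using infinite_super by blast
  then have "char_poly (indexed_mat vs ?M) - ?p * char_poly (indexed_mat cs ?K) = 0"
    using poly_roots_finite by blast
  then show ?thesis by (rule right_minus_eq[THEN iffD1])
qed

text \<open>The roots of a product, with multiplicities, are the sum of those of the factors once
  the product is nonzero; being monic ensures this here.\<close>

lemma char_poly_nonzero: "char_poly (indexed_mat xs g) \<noteq> 0"
  using degree_monic_char_poly[of "indexed_mat xs g" "length xs"] by (auto simp: indexed_mat_def)

lemma eigenvalue_mset_blowup:
  fixes a :: "'i \<Rightarrow> complex" and b :: "'i \<Rightarrow> 'i \<Rightarrow> complex" and f :: "'v \<Rightarrow> 'i"
  assumes vs: "distinct vs" and cs: "distinct cs" "set cs = f ` set vs"
  defines "n \<equiv> \<lambda>C. card {v \<in> set vs. f v = C}"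
  shows "eigenvalue_mset (indexed_mat vs (\<lambda>u v. (if u = v then a (f u) else 0) + b (f u) (f v)))
    = (\<Sum>C\<in>set cs. replicate_mset (n C - 1) (a C)) +
      eigenvalue_mset (indexed_mat cs (\<lambda>C D. (if C = D then a C else 0) +
        complex_of_real (sqrt (real (n C) * real (n D))) * b C D))"
proof -
  have "proots (\<Prod>C\<in>set cs. [:- a C, 1:] ^ (n C - 1)) = (\<Sum>C\<in>set cs. replicate_mset (n C - 1) (a C))"
    by (subst proots_prod) (auto simp: proots_power)
  then show ?thesis
    unfolding eigenvalue_mset_def n_def char_poly_blowup[OF vs cs]
    by (subst proots_mult) (auto simp: char_poly_nonzero)
qed

section \<open>Images and kernels of square matrices\<close>

text \<open>Vectors are functions vanishing from \<open>n\<close> on: this makes them a type of class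
  \<^class>\<open>ab_group_add\<close>, to which the locale \<^locale>\<open>vector_space\<close> applies.\<close>

abbreviation (input) fun_scale :: "'a::field \<Rightarrow> (nat \<Rightarrow> 'a) \<Rightarrow> nat \<Rightarrow> 'a" where
  "fun_scale c f \<equiv> \<lambda>i. c * f i"

lemma vector_space_fun_scale: "vector_space (fun_scale :: 'a::field \<Rightarrow> _)"
  by unfold_locales (auto simp: fun_eq_iff algebra_simps)

interpretation fv: finite_field_vector_space "fun_scale :: 'a::{field,finite} \<Rightarrow> _"
  unfolding finite_field_vector_space_def by (rule vector_space_fun_scale)

interpretation fvp: vector_space_pair "fun_scale :: 'a::{field,finite} \<Rightarrow> _" "fun_scale :: 'a \<Rightarrow> _"
  by (simp add: vector_space_pair_def vector_space_fun_scale)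

definition coord_space :: "nat \<Rightarrow> (nat \<Rightarrow> 'a::zero) set" where
  "coord_space n = {f. \<forall>i\<ge>n. f i = 0}"

lemma subspace_coord_space: "fv.subspace (coord_space n)"
  by (auto simp: coord_space_def fv.subspace_def)

lemma card_coord_space:
  "finite (coord_space n :: (nat \<Rightarrow> 'a::{field,finite}) set) \<and> card (coord_space n :: (nat \<Rightarrow> 'a) set) = CARD('a) ^ n"
proof -
  have "bij_betw (\<lambda>f. restrict f {..<n}) (coord_space n :: (nat \<Rightarrow> 'a) set) ({..<n} \<rightarrow>\<^sub>E UNIV)"
    by (rule bij_betw_byWitness[where f' = "\<lambda>f i. if i < n then f i else 0"])
       (auto simp: coord_space_def fun_eq_iff PiE_def extensional_def restrict_def)
  then show ?thesis
    by (simp add: bij_betw_same_card bij_betw_finite card_PiE finite_PiE)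
qed

lemma finite_coord_space: "finite (coord_space n :: (nat \<Rightarrow> 'a::{field,finite}) set)"
  using card_coord_space by blast

lemma dim_coord_space [simp]: "fv.dim (coord_space n :: (nat \<Rightarrow> 'a::{field,finite}) set) = n"
proof -
  have "CARD('a) ^ fv.dim (coord_space n :: (nat \<Rightarrow> 'a) set) = CARD('a) ^ n"
    using fv.card_subspace[OF subspace_coord_space finite_coord_space]
      card_coord_space[where 'a='a and n=n] by metis
  then show ?thesis by (rule fv.power_card_inject[THEN iffD1])
qed

text \<open>The operator is linear on all functions, so the facts about linear maps apply to it as
  it stands. The default value 0 from \<open>dim_row A\<close> on keeps its values in a coordinate
  space. Arguments are cut off at \<open>dim_col A\<close>, which is why image and kernel are taken
  within the coordinate space.\<close>

definition mat_app :: "'a::field mat \<Rightarrow> (nat \<Rightarrow> 'a) \<Rightarrow> nat \<Rightarrow> 'a" where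
  "mat_app A f = (\<lambda>i. if i < dim_row A then \<Sum>j<dim_col A. A $$ (i, j) * f j else 0)"

lemma linear_mat_app: "Vector_Spaces.linear fun_scale fun_scale (mat_app (A :: 'a::{field,finite} mat))"
  by (auto simp: Vector_Spaces.linear_iff vector_space_fun_scale mat_app_def fun_eq_iff
      algebra_simps sum.distrib sum_distrib_left)

lemma mat_app_closed: "A \<in> carrier_mat n n \<Longrightarrow> mat_app A f \<in> coord_space n"
  by (auto simp: coord_space_def mat_app_def)

lemma mat_app_mult:
  assumes "A \<in> carrier_mat n n" "B \<in> carrier_mat n n"
  shows "mat_app (A * B) f = mat_app A (mat_app B f)"
proof
  fix i
  have "(\<Sum>j<n. (\<Sum>k<n. A $$ (i, k) * B $$ (k, j)) * f j) = (\<Sum>k<n. A $$ (i, k) * (\<Sum>j<n. B $$ (k, j) * f j))"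
    unfolding sum_distrib_left sum_distrib_right
    by (subst sum.swap) (simp add: mult.assoc)
  moreover have "(\<Sum>j<n. (A * B) $$ (i, j) * f j) = (\<Sum>j<n. (\<Sum>k<n. A $$ (i, k) * B $$ (k, j)) * f j)" if "i < n"
    using assms that by (intro sum.cong) (auto simp: scalar_prod_def lessThan_atLeast0)
  ultimately show "mat_app (A * B) f i = mat_app A (mat_app B f) i"
    using assms by (auto simp: mat_app_def)
qed

lemma mat_app_one: "f \<in> coord_space n \<Longrightarrow> mat_app (1\<^sub>m n) f = f"
proof
  fix i assume f: "f \<in> coord_space n"
  have "(\<Sum>j<n. 1\<^sub>m n $$ (i, j) * f j) = (\<Sum>j<n. if i = j then f j else 0)" if "i < n"
    using that by (intro sum.cong) auto
  then show "mat_app (1\<^sub>m n) f i = f i" using f by (auto simp: mat_app_def coord_space_def)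
qed

lemma mat_app_zero [simp]: "mat_app (0\<^sub>m n n) f = 0"
  by (auto simp: mat_app_def fun_eq_iff)

definition unit_fun :: "nat \<Rightarrow> nat \<Rightarrow> 'a::zero_neq_one" where
  "unit_fun j = (\<lambda>i. if i = j then 1 else 0)"

lemma unit_fun_in: "j < n \<Longrightarrow> unit_fun j \<in> coord_space n"
  by (auto simp: unit_fun_def coord_space_def)

lemma mat_app_unit_fun:
  "j < dim_col A \<Longrightarrow> mat_app A (unit_fun j) = (\<lambda>i. if i < dim_row A then A $$ (i, j) else 0)"
  by (auto simp: mat_app_def unit_fun_def fun_eq_iff if_distrib[of "\<lambda>x. _ * x"] cong: if_cong)

lemma mat_app_inject:
  assumes "A \<in> carrier_mat n n" "B \<in> carrier_mat n n"
    and eq: "\<And>f. f \<in> coord_space n \<Longrightarrow> mat_app A f = mat_app B f"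
  shows "A = B"
proof (rule eq_matI)
  fix i j assume "i < dim_row B" "j < dim_col B"
  then show "A $$ (i, j) = B $$ (i, j)"
    using fun_cong[OF eq[OF unit_fun_in[of j n]], of i] assms by (simp add: mat_app_unit_fun)
qed (use assms in auto)

lemma coord_space_sum:
  assumes "f \<in> coord_space n"
  shows "f = (\<Sum>j<n. fun_scale (f j) (unit_fun j))"
proof
  fix i
  have "(\<Sum>j<n. fun_scale (f j) (unit_fun j)) i = (\<Sum>j<n. f j * unit_fun j i)"
    by (induction n) auto
  also have "\<dots> = f i" using assms
    by (auto simp: unit_fun_def coord_space_def if_distrib[of "\<lambda>x. _ * x"] cong: if_cong)
  finally show "f i = (\<Sum>j<n. fun_scale (f j) (unit_fun j)) i" by simp
qed

lemma mat_app_represents: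
  fixes g :: "(nat \<Rightarrow> 'a::{field,finite}) \<Rightarrow> nat \<Rightarrow> 'a"
  assumes lin: "Vector_Spaces.linear fun_scale fun_scale g"
    and cl: "\<And>f. f \<in> coord_space n \<Longrightarrow> g f \<in> coord_space n"
  obtains A where "A \<in> carrier_mat n n" "\<And>f. f \<in> coord_space n \<Longrightarrow> mat_app A f = g f"
proof
  define A where "A = mat n n (\<lambda>(i, j). g (unit_fun j) i)"
  show A: "A \<in> carrier_mat n n" by (simp add: A_def)
  have u: "mat_app A (unit_fun j) = g (unit_fun j)" if "j < n" for j
    using cl[OF unit_fun_in[OF that]] that by (auto simp: A_def mat_app_unit_fun coord_space_def fun_eq_iff)
  fix f :: "nat \<Rightarrow> 'a" assume f: "f \<in> coord_space n"
  have "mat_app A f = mat_app A (\<Sum>j<n. fun_scale (f j) (unit_fun j))"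
    using coord_space_sum[OF f] by simp
  also have "\<dots> = (\<Sum>j<n. fun_scale (f j) (mat_app A (unit_fun j)))"
    by (simp only: fvp.linear_sum[OF linear_mat_app] fvp.linear_scale[OF linear_mat_app])
  also have "\<dots> = (\<Sum>j<n. fun_scale (f j) (g (unit_fun j)))" by (simp add: u)
  also have "\<dots> = g (\<Sum>j<n. fun_scale (f j) (unit_fun j))"
    by (simp only: fvp.linear_sum[OF lin] fvp.linear_scale[OF lin])
  also have "\<dots> = g f" using coord_space_sum[OF f] by simp
  finally show "mat_app A f = g f" .
qed

text \<open>The linear extension of g is a map on all functions; it preserves the coordinate space
  because B spans this space and g takes values in it, and such a map is given by a matrix.\<close>

lemma mat_with_values_on_basis:
  fixes B :: "(nat \<Rightarrow> 'a::{field,finite}) set"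
  assumes "fv.independent B" "fv.span B = coord_space n" "\<And>b. b \<in> B \<Longrightarrow> g b \<in> coord_space n"
  obtains A where "A \<in> carrier_mat n n" "\<And>b. b \<in> B \<Longrightarrow> mat_app A b = g b"
proof -
  obtain h where h: "Vector_Spaces.linear fun_scale fun_scale h" "\<And>b. b \<in> B \<Longrightarrow> h b = g b"
    using fvp.linear_independent_extend[OF assms(1)] by blast
  have "h ` coord_space n = fv.span (h ` B)"
    using fvp.linear_span_image[OF h(1), of B] assms(2) by simp
  also have "\<dots> \<subseteq> coord_space n"
    by (rule fv.span_minimal) (use h assms subspace_coord_space in auto)
  finally have "\<And>f. f \<in> coord_space n \<Longrightarrow> h f \<in> coord_space n" by blast
  then obtain A where "A \<in> carrier_mat n n" "\<And>f. f \<in> coord_space n \<Longrightarrow> mat_app A f = h f"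
    using mat_app_represents[OF h(1)] by blast
  with h that show ?thesis using assms(2) fv.span_base by metis
qed

lemma mat_eq_on_basis:
  fixes A B :: "'a::{field,finite} mat"
  assumes "A \<in> carrier_mat n n" "B \<in> carrier_mat n n" "fv.span S = coord_space n"
    and "\<And>b. b \<in> S \<Longrightarrow> mat_app A b = mat_app B b"
  shows "A = B"
  using assms fvp.linear_eq_on[OF linear_mat_app linear_mat_app, of _ S A B]
  by (intro mat_app_inject[of A n B]) auto

section \<open>Image, kernel and bases adapted to the kernel\<close>

definition mat_img :: "'a::field mat \<Rightarrow> (nat \<Rightarrow> 'a) set" where
  "mat_img A = mat_app A ` coord_space (dim_col A)"

definition mat_ker :: "'a::field mat \<Rightarrow> (nat \<Rightarrow> 'a) set" where
  "mat_ker A = {f \<in> coord_space (dim_col A). mat_app A f = 0}"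

lemma mat_img_subspace:
  fixes A :: "'a::{field,finite} mat"
  assumes "A \<in> carrier_mat n n"
  shows "fv.subspace (mat_img A)" "mat_img A \<subseteq> coord_space n" "finite (mat_img A)"
  using fvp.linear_subspace_image[OF linear_mat_app subspace_coord_space, of A n] assms
    mat_app_closed[OF assms] finite_coord_space
  by (auto simp: mat_img_def)

lemma mat_ker_subspace:
  fixes A :: "'a::{field,finite} mat"
  assumes "A \<in> carrier_mat n n"
  shows "fv.subspace (mat_ker A)" "mat_ker A \<subseteq> coord_space n" "finite (mat_ker A)"
proof -
  have "mat_ker A = coord_space n \<inter> {f. mat_app A f = 0}"
    using assms by (auto simp: mat_ker_def)
  then show "fv.subspace (mat_ker A)" "mat_ker A \<subseteq> coord_space n" "finite (mat_ker A)"
    using fv.subspace_inter[OF subspace_coord_space fvp.linear_subspace_kernel[OF linear_mat_app]]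
      finite_coord_space[where n=n and 'a='a] by auto
qed

lemma extend_to_basis:
  fixes K :: "(nat \<Rightarrow> 'a::{field,finite}) set"
  assumes "fv.independent K" "K \<subseteq> coord_space n"
  obtains C where "finite K" "finite C" "K \<inter> C = {}" "C \<subseteq> coord_space n" "fv.independent (K \<union> C)"
    "fv.span (K \<union> C) = coord_space n" "card K + card C = n"
proof -
  obtain B where B: "K \<subseteq> B" "B \<subseteq> coord_space n" "finite B" "fv.independent B"
      "fv.span B = coord_space n" "card B = fv.dim (coord_space n :: (nat \<Rightarrow> 'a) set)"
    using fv.subspace_basis[OF subspace_coord_space finite_coord_space assms(2,1)] by metis
  show ?thesis
  proof (rule that[of "B - K"])
    have KB: "K \<union> (B - K) = B" using B by blast
    show "finite K" using B finite_subset by blast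
    then show "card K + card (B - K) = n"
      using B card_Un_disjoint[of K "B - K"] KB by simp
  qed (use B in \<open>auto simp: Un_absorb1\<close>)
qed

text \<open>The span of C meets the kernel only in 0, so A is injective on it, and K contributes
  nothing to the image. Hence A carries C to a basis of its image, which is the content of
  rank-nullity.\<close>

lemma mat_app_adapted_basis:
  fixes A :: "'a::{field,finite} mat"
  assumes A: "A \<in> carrier_mat n n" and fin: "finite K" "finite C" and disj: "K \<inter> C = {}"
    and ind: "fv.independent (K \<union> C)" and sp: "fv.span (K \<union> C) = coord_space n"
    and ker: "fv.span K = mat_ker A"
  shows "inj_on (mat_app A) C" "fv.independent (mat_app A ` C)" "fv.span (mat_app A ` C) = mat_img A"
    "fv.dim (mat_img A) = card C" "fv.dim (mat_ker A) = card K"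
proof -
  have indK: "fv.independent K" and indC: "fv.independent C"
    using ind fv.independent_mono by blast+
  have "fv.span K \<inter> fv.span C = {0}"
    using fv.independent_Un_iff[OF fin indK indC] disj ind by blast
  moreover have "fv.span C \<subseteq> coord_space n" using sp fv.span_mono by blast
  ultimately have "\<forall>x\<in>fv.span C. mat_app A x = 0 \<longrightarrow> x = 0"
    using ker A by (auto simp: mat_ker_def)
  then have inj: "inj_on (mat_app A) (fv.span C)"
    using fvp.linear_inj_on_iff_eq_0[OF linear_mat_app fv.subspace_span] by blast
  then show 1: "inj_on (mat_app A) C" using fv.span_superset inj_on_subset by blast
  show 2: "fv.independent (mat_app A ` C)"
    using fvp.linear_independent_injective_image[OF linear_mat_app indC inj] .
  have "mat_img A = mat_app A ` fv.span (K \<union> C)" using A sp by (simp add: mat_img_def)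
  also have "\<dots> = fv.span (mat_app A ` K \<union> mat_app A ` C)"
    by (simp only: fvp.linear_span_image[OF linear_mat_app, symmetric] image_Un)
  also have "\<dots> = fv.span (mat_app A ` C)"
  proof (rule antisym)
    have "mat_app A ` K \<subseteq> {0}" using ker fv.span_superset by (auto simp: mat_ker_def)
    then show "fv.span (mat_app A ` K \<union> mat_app A ` C) \<subseteq> fv.span (mat_app A ` C)"
      using fv.span_zero[of "mat_app A ` C"] fv.span_superset[of "mat_app A ` C"]
      by (intro fv.span_minimal[OF _ fv.subspace_span] Un_least) (auto simp: subset_iff)
  qed (simp add: fv.span_mono)
  finally show 3: "fv.span (mat_app A ` C) = mat_img A" ..
  show "fv.dim (mat_img A) = card C"
    using fv.dim_span_eq_card_independent[OF 2] 1 by (simp add: 3 card_image)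
  show "fv.dim (mat_ker A) = card K"
    using fv.dim_span_eq_card_independent[OF indK] by (simp add: ker)
qed

lemma adapted_basis_exists:
  fixes W :: "(nat \<Rightarrow> 'a::{field,finite}) set"
  assumes "fv.subspace W" "W \<subseteq> coord_space n"
  obtains K C where "finite K" "finite C" "K \<inter> C = {}" "C \<subseteq> coord_space n" "fv.independent (K \<union> C)"
    "fv.span (K \<union> C) = coord_space n" "fv.span K = W" "card K = fv.dim W" "fv.dim W + card C = n"
proof -
  have "finite W" using assms finite_coord_space finite_subset by blast
  then obtain K where K: "K \<subseteq> W" "fv.independent K" "fv.span K = W" "card K = fv.dim W"
    using fv.subspace_basis[OF assms(1) _ empty_subsetI fv.independent_empty] by metis
  then obtain C where "finite K" "finite C" "K \<inter> C = {}" "C \<subseteq> coord_space n" "fv.independent (K \<union> C)"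
    "fv.span (K \<union> C) = coord_space n" "card K + card C = n"
    using extend_to_basis[of K n] assms(2) by blast
  with K that show ?thesis by metis
qed

lemma rank_nullity:
  fixes A :: "'a::{field,finite} mat"
  assumes "A \<in> carrier_mat n n"
  shows "fv.dim (mat_img A) + fv.dim (mat_ker A) = n"
proof -
  obtain K C where "finite K" "finite C" "K \<inter> C = {}" "C \<subseteq> coord_space n" "fv.independent (K \<union> C)"
    "fv.span (K \<union> C) = coord_space n" "fv.span K = mat_ker A" "fv.dim (mat_ker A) + card C = n"
    using adapted_basis_exists[OF mat_ker_subspace(1,2)[OF assms]] by metis
  then show ?thesis using mat_app_adapted_basis(4)[OF assms] by simp
qed

definition img_ker_class :: "nat \<Rightarrow> (nat \<Rightarrow> 'a) set \<times> (nat \<Rightarrow> 'a) set \<Rightarrow> 'a::field mat set" where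
  "img_ker_class n = (\<lambda>(U, W). {A \<in> carrier_mat n n. mat_img A = U \<and> mat_ker A = W})"

text \<open>The dimensions of U and W sum to n, and so do those of image and kernel by rank-nullity;
  neither inclusion can be strict. This reduces membership in a class to two inclusions.\<close>

lemma mat_img_ker_eqI:
  fixes A :: "'a::{field,finite} mat"
  assumes A: "A \<in> carrier_mat n n" and U: "fv.subspace U" "U \<subseteq> mat_img A"
    and W: "fv.subspace W" "W \<subseteq> mat_ker A" and d: "fv.dim U + fv.dim W = n"
  shows "mat_img A = U" "mat_ker A = W"
proof -
  note I = mat_img_subspace[OF A] and K = mat_ker_subspace[OF A]
  have "fv.dim U \<le> fv.dim (mat_img A)" "fv.dim W \<le> fv.dim (mat_ker A)"
    using fv.dim_mono_finite I K U W by auto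
  then have "fv.dim U = fv.dim (mat_img A)" "fv.dim W = fv.dim (mat_ker A)"
    using rank_nullity[OF A] d by auto
  then show "mat_img A = U" "mat_ker A = W"
    using fv.subspace_eq_of_dim I K U W by metis+
qed

lemma card_img_ker_class:
  fixes U W :: "(nat \<Rightarrow> 'a::{field,finite}) set"
  assumes U: "fv.subspace U" "U \<subseteq> coord_space n" and W: "fv.subspace W" "W \<subseteq> coord_space n"
    and d: "fv.dim U + fv.dim W = n"
  shows "real (card (img_ker_class n (U, W))) =
    (\<Prod>i<fv.dim U. real CARD('a) ^ fv.dim U - real CARD('a) ^ i)"
proof -
  have finU: "finite U" using U finite_coord_space finite_subset by blast
  obtain K C where KC: "finite K" "finite C" "K \<inter> C = {}" "C \<subseteq> coord_space n" "fv.independent (K \<union> C)"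
    "fv.span (K \<union> C) = coord_space n" "fv.span K = W" "fv.dim W + card C = n"
    using adapted_basis_exists[OF W] by metis
  then have cC: "card C = fv.dim U" using d by simp
  obtain cs where cs: "set cs = C" "distinct cs" using finite_distinct_list[OF KC(2)] by blast
  have len: "length cs = fv.dim U" using cC cs(1) distinct_card[OF cs(2)] by simp
  \<comment> \<open>The target consists of the ordered bases of U, and \<open>cs\<close> is an
    ordered basis of a complement of W.\<close>
  have "bij_betw (\<lambda>A. map (mat_app A) cs) (img_ker_class n (U, W)) (fv.extensions {} U (fv.dim U))"
    unfolding bij_betw_def
  proof (intro conjI inj_onI Set.set_eqI iffI)
    fix A B :: "'a mat"
    assume A: "A \<in> img_ker_class n (U, W)" and B: "B \<in> img_ker_class n (U, W)"
      and eq: "map (mat_app A) cs = map (mat_app B) cs"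
    have "mat_app A k = 0 \<and> mat_app B k = 0" if "k \<in> K" for k
      using that KC(7) fv.span_base[OF that] A B by (auto simp: img_ker_class_def mat_ker_def)
    then show "A = B"
      using A B eq cs by (intro mat_eq_on_basis[OF _ _ KC(6)]) (auto simp: img_ker_class_def)
  next
    fix us assume "us \<in> (\<lambda>A. map (mat_app A) cs) ` img_ker_class n (U, W)"
    then obtain A where A: "A \<in> carrier_mat n n" "mat_img A = U" "mat_ker A = W"
      and us: "us = map (mat_app A) cs" by (auto simp: img_ker_class_def)
    have ker: "fv.span K = mat_ker A" using A KC by simp
    note * = mat_app_adapted_basis[OF A(1) KC(1,2,3,5,6) ker]
    have "mat_app A ` C \<subseteq> U" using *(3) A fv.span_superset by metis
    then show "us \<in> fv.extensions {} U (fv.dim U)"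
      using * cs len by (auto simp: fv.extensions_def us distinct_map)
  next
    fix us assume us: "us \<in> fv.extensions {} U (fv.dim U)"
    \<comment> \<open>The value at the i-th vector of \<open>cs\<close> is the i-th entry of
      \<open>us\<close>, the index being unique as \<open>cs\<close> is distinct. The default 0
      applies to K and places W in the kernel.\<close>
    define g where "g x = (if x \<in> C then us ! (SOME i. i < length cs \<and> cs ! i = x) else 0)" for x
    have g: "g (cs ! i) = us ! i" if "i < length cs" for i
    proof -
      have "(SOME j. j < length cs \<and> cs ! j = cs ! i) = i"
        using that cs(2) by (intro some_equality) (auto simp: nth_eq_iff_index_eq)
      then show ?thesis using that cs by (auto simp: g_def)
    qed
    have lus: "length us = length cs" using us len by (simp add: fv.extensions_def)
    have "g x \<in> coord_space n" for x
    proof (cases "x \<in> C")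
      case True
      then obtain i where "i < length cs" "x = cs ! i" using cs by (metis in_set_conv_nth)
      moreover from this have "us ! i \<in> set us" using lus by simp
      ultimately show ?thesis using g us U by (auto simp: fv.extensions_def)
    qed (auto simp: g_def coord_space_def)
    then obtain A where A: "A \<in> carrier_mat n n" and Ag: "\<And>b. b \<in> K \<union> C \<Longrightarrow> mat_app A b = g b"
      using mat_with_values_on_basis[OF KC(5,6)] by metis
    have map: "map (mat_app A) cs = us"
      using lus Ag cs g by (intro nth_equalityI) auto
    have sub: "set us \<subseteq> mat_img A"
    proof -
      have "C \<subseteq> coord_space n" by fact
      then have "mat_app A ` C \<subseteq> mat_img A" using A by (auto simp: mat_img_def)
      then show ?thesis using map cs by (metis list.set_map)
    qed
    have "fv.span (set us) = U"
      using fv.extensions_span[OF U(1) finU empty_subsetI us]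
      by (intro fv.subspace_eq_of_dim[OF fv.subspace_span U(1) finU]) auto
    then have "U \<subseteq> mat_img A"
      using fv.span_minimal[OF sub mat_img_subspace(1)[OF A]] by simp
    moreover have "W \<subseteq> mat_ker A"
    proof -
      have "mat_app A k = 0" if "k \<in> K" for k using Ag[of k] that KC(3) by (auto simp: g_def)
      then have "K \<subseteq> mat_ker A" using A W KC(7) fv.span_base by (auto simp: mat_ker_def)
      then show ?thesis using fv.span_minimal mat_ker_subspace[OF A] KC(7) by metis
    qed
    ultimately have "A \<in> img_ker_class n (U, W)"
      using mat_img_ker_eqI[OF A U(1) _ W(1) _ d] A by (simp add: img_ker_class_def)
    then show "us \<in> (\<lambda>A. map (mat_app A) cs) ` img_ker_class n (U, W)" using map by force
  qed
  then have "card (img_ker_class n (U, W)) = card (fv.extensions {} U (fv.dim U))"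
    by (rule bij_betw_same_card)
  then show ?thesis
    using fv.card_extensions[OF U(1) finU empty_subsetI fv.independent_empty, of "fv.dim U"] by simp
qed

text \<open>Existence is read off from the count: all factors q^r - q^i with i < r are
  nonzero.\<close>

lemma img_ker_class_nonempty:
  fixes U W :: "(nat \<Rightarrow> 'a::{field,finite}) set"
  assumes "fv.subspace U" "U \<subseteq> coord_space n" "fv.subspace W" "W \<subseteq> coord_space n"
    "fv.dim U + fv.dim W = n"
  shows "img_ker_class n (U, W) \<noteq> {}"
proof -
  have "(\<Prod>i<fv.dim U. real CARD('a) ^ fv.dim U - real CARD('a) ^ i) \<noteq> 0"
    using finite_field_card_ge_2[where 'a='a] by auto
  then show ?thesis using card_img_ker_class[OF assms] by auto
qed

section \<open>The column rank is the dimension of the image\<close>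

lemma coord_space_eq_span: "coord_space n = fv.span (unit_fun ` {..<n} :: (nat \<Rightarrow> 'a::{field,finite}) set)"
proof (rule antisym)
  show "coord_space n \<subseteq> fv.span (unit_fun ` {..<n} :: (nat \<Rightarrow> 'a) set)"
  proof
    fix f :: "nat \<Rightarrow> 'a" assume "f \<in> coord_space n"
    then have "f = (\<Sum>j<n. fun_scale (f j) (unit_fun j))" by (rule coord_space_sum)
    also have "\<dots> \<in> fv.span (unit_fun ` {..<n})"
      by (intro fv.span_sum fv.span_scale fv.span_base) auto
    finally show "f \<in> fv.span (unit_fun ` {..<n})" .
  qed
  show "fv.span (unit_fun ` {..<n} :: (nat \<Rightarrow> 'a) set) \<subseteq> coord_space n"
    by (intro fv.span_minimal subspace_coord_space) (auto intro: unit_fun_in)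
qed

definition vec_fun :: "nat \<Rightarrow> 'a::zero vec \<Rightarrow> nat \<Rightarrow> 'a" where
  "vec_fun n v = (\<lambda>i. if i < n then v $ i else 0)"

lemma vec_fun_apply: "vec_fun n v i = (if i < n then v $ i else 0)"
  by (simp add: vec_fun_def)

lemma inj_on_vec_fun: "inj_on (vec_fun n) (carrier_vec n)"
proof (rule inj_onI)
  fix v w :: "'a vec" assume v: "v \<in> carrier_vec n" "w \<in> carrier_vec n" and eq: "vec_fun n v = vec_fun n w"
  show "v = w"
  proof (rule eq_vecI)
    fix i assume "i < dim_vec w"
    then show "v $ i = w $ i" using fun_cong[OF eq, of i] v by (simp add: vec_fun_def)
  qed (use v in auto)
qed

lemma mat_img_eq_span_cols:
  fixes A :: "'a::{field,finite} mat"
  assumes A: "A \<in> carrier_mat n n"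
  shows "mat_img A = fv.span (vec_fun n ` set (cols A))"
proof -
  have "mat_app A (unit_fun j) = vec_fun n (col A j)" if "j < n" for j
    using A that by (auto simp: mat_app_unit_fun vec_fun_def fun_eq_iff)
  then have "mat_app A ` unit_fun ` {..<n} = vec_fun n ` col A ` {..<n}"
    by (force simp: image_image)
  moreover have "set (cols A) = col A ` {..<n}"
    using A by (auto simp: cols_def)
  ultimately show ?thesis
    using A fvp.linear_span_image[OF linear_mat_app, of A "unit_fun ` {..<n}"]
    by (simp add: mat_img_def coord_space_eq_span)
qed

lemma sum_vec_fun_eq_0_iff:
  fixes S :: "'a::{field,finite} vec set"
  assumes "finite S" "S \<subseteq> carrier_vec n"
  shows "(\<Sum>x\<in>vec_fun n ` S. fun_scale (u x) x) = 0 \<longleftrightarrow>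
    (\<forall>i<n. (\<Sum>v\<in>S. u (vec_fun n v) * v $ i) = 0)"
proof -
  have inj: "inj_on (vec_fun n) S" using inj_on_vec_fun assms(2) inj_on_subset by blast
  have "(\<Sum>x\<in>vec_fun n ` S. fun_scale (u x) x) = (\<Sum>v\<in>S. fun_scale (u (vec_fun n v)) (vec_fun n v))"
    by (simp add: sum.reindex[OF inj])
  also have "\<dots> = (\<lambda>i. \<Sum>v\<in>S. u (vec_fun n v) * vec_fun n v i)"
    using assms(1) by (induction S rule: finite_induct) (auto simp: fun_eq_iff)
  also have "\<dots> = (\<lambda>i. if i < n then \<Sum>v\<in>S. u (vec_fun n v) * v $ i else 0)"
    by (auto simp: fun_eq_iff vec_fun_apply)
  finally show ?thesis by (auto simp: fun_eq_iff)
qed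

text \<open>Both notions ask for a vanishing finite combination, which can be tested on the
  coordinates below n. Coefficients are carried over along \<open>vec_fun n\<close> in one direction
  and along its inverse in the other, using injectivity on vectors of length n.\<close>

lemma lin_dep_iff_dependent:
  fixes S :: "'a::{field,finite} vec set"
  assumes S: "S \<subseteq> carrier_vec n"
  shows "module.lin_dep class_ring (module_vec TYPE('a) n) S \<longleftrightarrow> fv.dependent (vec_fun n ` S)"
proof -
  interpret V: vec_space "TYPE('a)" n .
  have zero: "V.lincomb a T = 0\<^sub>v n \<longleftrightarrow> (\<forall>i<n. (\<Sum>v\<in>T. a v * v $ i) = 0)"
    if T: "T \<subseteq> S" "finite T" for a T
  proof -
    have TC: "T \<subseteq> carrier_vec n" using T S by blast
    have "V.lincomb a T \<in> carrier_vec n" by (rule carrier_vecI[OF V.lincomb_dim[OF T(2) TC]])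
    then have "V.lincomb a T = 0\<^sub>v n \<longleftrightarrow> (\<forall>i<n. V.lincomb a T $ i = 0)" by auto
    then show ?thesis using V.lincomb_index[OF _ TC] by simp
  qed
  show ?thesis
  proof
    assume "V.lin_dep S"
    then obtain T a v where T: "finite T" "T \<subseteq> S" "V.lincomb a T = 0\<^sub>v n" "v \<in> T" "a v \<noteq> 0"
      unfolding V.lin_dep_def by (auto simp: module_vec_simps class_ring_simps)
    have TC: "T \<subseteq> carrier_vec n" using T S by blast
    have inj: "inj_on (vec_fun n) T" using inj_on_vec_fun TC inj_on_subset by blast
    let ?u = "\<lambda>x. a (inv_into T (vec_fun n) x)"
    have u: "?u (vec_fun n w) = a w" if "w \<in> T" for w using inv_into_f_f[OF inj that] by simp
    have "(\<Sum>x\<in>vec_fun n ` T. fun_scale (?u x) x) = 0"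
      using zero[OF T(2,1)] T(3) by (simp add: sum_vec_fun_eq_0_iff[OF T(1) TC] u)
    then show "fv.dependent (vec_fun n ` S)"
      unfolding fv.dependent_explicit
      using T u by (intro exI[of _ "vec_fun n ` T"] exI[of _ ?u]) auto
  next
    assume "fv.dependent (vec_fun n ` S)"
    then obtain t u where t: "finite t" "t \<subseteq> vec_fun n ` S" "(\<Sum>x\<in>t. fun_scale (u x) x) = 0"
      "\<exists>x\<in>t. u x \<noteq> 0"
      unfolding fv.dependent_explicit by blast
    then obtain T where T: "T \<subseteq> S" "finite T" "t = vec_fun n ` T"
      using finite_subset_image[of t "vec_fun n" S] by blast
    have TC: "T \<subseteq> carrier_vec n" using T S by blast
    have "V.lincomb (\<lambda>v. u (vec_fun n v)) T = 0\<^sub>v n"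
      using t(3) unfolding T(3) sum_vec_fun_eq_0_iff[OF T(2) TC] zero[OF T(1,2)] .
    moreover obtain v where "v \<in> T" "u (vec_fun n v) \<noteq> 0" using t(4) T(3) by blast
    ultimately show "V.lin_dep S"
      unfolding V.lin_dep_def using T
      by (intro exI[of _ T] exI[of _ "\<lambda>v. u (vec_fun n v)"] exI[of _ v])
         (auto simp: module_vec_simps class_ring_simps)
  qed
qed

text \<open>The rank is the size of any maximal independent set of columns. By maximality such a set
  spans all the columns, and these span the image.\<close>

lemma rank_eq_dim_img:
  fixes A :: "'a::{field,finite} mat"
  assumes A: "A \<in> carrier_mat n n"
  shows "vec_space.rank n A = fv.dim (mat_img A)"
proof -
  interpret V: vec_space "TYPE('a)" n .
  have cols: "set (cols A) \<subseteq> carrier_vec n" using A cols_dim by blast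
  let ?P = "\<lambda>T. T \<subseteq> set (cols A) \<and> V.lin_indpt T"
  have "?P {}" using lin_dep_iff_dependent[of "{}" n] fv.independent_empty by auto
  then obtain S where S: "maximal S ?P"
    using maximal_exists_superset[of "set (cols A)" ?P "{}"] by auto
  have sub: "S \<subseteq> set (cols A)" and li: "V.lin_indpt S" using S by (auto simp: maximal_def)
  have SC: "S \<subseteq> carrier_vec n" using sub cols by blast
  have ind: "fv.independent (vec_fun n ` S)" using li lin_dep_iff_dependent[OF SC] by blast
  have "vec_fun n ` set (cols A) \<subseteq> fv.span (vec_fun n ` S)"
  proof clarify
    fix c assume c: "c \<in> set (cols A)"
    show "vec_fun n c \<in> fv.span (vec_fun n ` S)"
    proof (rule ccontr)
      assume nin: "vec_fun n c \<notin> fv.span (vec_fun n ` S)"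
      then have "fv.independent (vec_fun n ` insert c S)"
        using ind by (simp add: fv.independent_insertI)
      then have "V.lin_indpt (insert c S)"
        using lin_dep_iff_dependent[of "insert c S" n] SC c cols by blast
      then have "insert c S = S" using S sub c unfolding maximal_def by blast
      then show False using nin fv.span_base by blast
    qed
  qed
  then have "fv.span (vec_fun n ` S) = mat_img A"
    unfolding mat_img_eq_span_cols[OF A]
    using fv.span_minimal[OF _ fv.subspace_span] fv.span_mono[OF image_mono[OF sub], of "vec_fun n"] by (metis subset_antisym)
  then have "fv.dim (mat_img A) = card (vec_fun n ` S)"
    using fv.dim_span_eq_card_independent[OF ind] by simp
  also have "\<dots> = card S"
    using inj_on_vec_fun SC inj_on_subset card_image by blast
  also have "\<dots> = V.rank A" using V.rank_card_indpt[OF A S] by simp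
  finally show ?thesis by simp
qed

section \<open>Vanishing products and units in terms of image and kernel\<close>

lemma mat_img_eq_0_iff:
  fixes A :: "'a::{field,finite} mat"
  assumes A: "A \<in> carrier_mat n n"
  shows "fv.dim (mat_img A) = 0 \<longleftrightarrow> A = 0\<^sub>m n n"
proof -
  have "mat_img A = {0} \<longleftrightarrow> A = 0\<^sub>m n n"
  proof
    assume "mat_img A = {0}"
    then show "A = 0\<^sub>m n n"
      using A by (intro mat_app_inject[OF A]) (auto simp: mat_img_def)
  next
    assume "A = 0\<^sub>m n n"
    then show "mat_img A = {0}"
      using fv.subspace_0[OF subspace_coord_space] by (auto simp: mat_img_def)
  qed
  then show ?thesis using fv.dim_eq_0_finite mat_img_subspace[OF A] by metis
qed

lemma mult_eq_0_iff_img_ker: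
  fixes A B :: "'a::{field,finite} mat"
  assumes A: "A \<in> carrier_mat n n" and B: "B \<in> carrier_mat n n"
  shows "A * B = 0\<^sub>m n n \<longleftrightarrow> mat_img B \<subseteq> mat_ker A"
proof
  assume AB: "A * B = 0\<^sub>m n n"
  have "mat_app A (mat_app B f) = 0" for f
    using mat_app_mult[OF A B, of f] by (simp add: AB)
  then show "mat_img B \<subseteq> mat_ker A"
    using A B mat_app_closed[OF B] by (auto simp: mat_img_def mat_ker_def)
next
  assume "mat_img B \<subseteq> mat_ker A"
  then show "A * B = 0\<^sub>m n n"
    using A B by (intro mat_app_inject[of _ n]) (auto simp: mat_app_mult[OF A B] mat_img_def mat_ker_def)
qed

text \<open>Sending each basis vector to a chosen preimage defines a right inverse, which is
  two-sided for square matrices.\<close>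

lemma img_full_imp_unit:
  fixes A :: "'a::{field,finite} mat"
  assumes A: "A \<in> carrier_mat n n" and img: "coord_space n \<subseteq> mat_img A"
  shows "A \<in> Units (ring_mat TYPE('a) n ())"
proof -
  obtain B :: "(nat \<Rightarrow> 'a) set" where "fv.independent ({} \<union> B)" "fv.span ({} \<union> B) = coord_space n"
    by (rule extend_to_basis[OF fv.independent_empty empty_subsetI, where n = n])
  then have B: "fv.independent B" "fv.span B = coord_space n" by simp_all
  have "\<exists>y. y \<in> coord_space n \<and> mat_app A y = b" if "b \<in> B" for b
    using img A fv.span_base[OF that] B by (auto simp: mat_img_def)
  then obtain g where g: "\<And>b. b \<in> B \<Longrightarrow> g b \<in> coord_space n" "\<And>b. b \<in> B \<Longrightarrow> mat_app A (g b) = b"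
    by metis
  obtain C where C: "C \<in> carrier_mat n n" "\<And>b. b \<in> B \<Longrightarrow> mat_app C b = g b"
    using mat_with_values_on_basis[OF B, where g = g] g(1) by blast
  have BV: "B \<subseteq> coord_space n" using B fv.span_superset by metis
  have "A * C = 1\<^sub>m n"
  proof (rule mat_eq_on_basis[OF _ _ B(2)])
    fix b assume b: "b \<in> B"
    then show "mat_app (A * C) b = mat_app (1\<^sub>m n) b"
      using BV by (subst mat_app_mult[OF A C(1)], subst mat_app_one) (auto simp: C(2) g(2))
  qed (use A C in auto)
  moreover from this have "C * A = 1\<^sub>m n" using mat_mult_left_right_inverse[OF A C(1)] by blast
  ultimately show ?thesis using A C by (auto simp: Units_def ring_mat_simps)
qed

lemma unit_img_full:
  fixes u :: "'a::{field,finite} mat"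
  assumes "u \<in> Units (ring_mat TYPE('a) n ())"
  shows "u \<in> carrier_mat n n" "mat_img u = coord_space n"
proof -
  obtain v where uv: "u \<in> carrier_mat n n" "v \<in> carrier_mat n n" "u * v = 1\<^sub>m n"
    using assms by (auto simp: Units_def ring_mat_simps)
  then show "u \<in> carrier_mat n n" by simp
  have "f \<in> mat_img u" if "f \<in> coord_space n" for f
    using mat_app_mult[OF uv(1,2), of f] mat_app_one[OF that] uv mat_app_closed[OF uv(2), of f]
    by (auto simp: mat_img_def)
  then show "mat_img u = coord_space n" using mat_img_subspace[OF uv(1)] by blast
qed

lemma mat_img_mult_unit:
  fixes B v :: "'a::{field,finite} mat"
  assumes B: "B \<in> carrier_mat n n" and v: "v \<in> Units (ring_mat TYPE('a) n ())"
  shows "mat_img (B * v) = mat_img B"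
proof -
  note v' = unit_img_full[OF v]
  have "mat_img (B * v) = mat_app B ` (mat_app v ` coord_space n)"
    using B v'(1) by (simp add: mat_img_def image_image mat_app_mult[OF B v'(1)])
  also have "mat_app v ` coord_space n = coord_space n"
    using v' by (simp add: mat_img_def)
  finally show ?thesis using B by (simp add: mat_img_def)
qed

lemma unit_ker_trivial:
  fixes u :: "'a::{field,finite} mat"
  assumes "u \<in> Units (ring_mat TYPE('a) n ())" "f \<in> coord_space n" "mat_app u f = 0"
  shows "f = 0"
proof -
  note u = unit_img_full[OF assms(1)]
  have "fv.dim (mat_ker u) = 0" using rank_nullity[OF u(1)] u(2) by simp
  then have "mat_ker u = {0}" using fv.dim_eq_0_finite mat_ker_subspace[OF u(1)] by metis
  then show ?thesis using assms u by (auto simp: mat_ker_def)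
qed

lemma mat_ker_unit_mult:
  fixes B u :: "'a::{field,finite} mat"
  assumes B: "B \<in> carrier_mat n n" and u: "u \<in> Units (ring_mat TYPE('a) n ())"
  shows "mat_ker (u * B) = mat_ker B"
proof -
  note u' = unit_img_full[OF u]
  have "mat_app u (mat_app B f) = 0 \<longleftrightarrow> mat_app B f = 0" for f
    using unit_ker_trivial[OF u mat_app_closed[OF B]] fvp.linear_0[OF linear_mat_app] by metis
  then show ?thesis using B u' by (auto simp: mat_ker_def mat_app_mult)
qed

text \<open>On the basis K of the kernel v is the identity; on C it takes a preimage under B of the
  value of A, available because the images agree. If v f = 0 then A f = B (v f) = 0, so f lies in
  the kernel, where v fixes it, and f = 0. Thus v is injective and hence a unit.\<close>

lemma img_ker_eq_imp_right_unit:
  fixes A B :: "'a::{field,finite} mat"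
  assumes A: "A \<in> carrier_mat n n" and B: "B \<in> carrier_mat n n"
    and img: "mat_img A = mat_img B" and ker: "mat_ker A = mat_ker B"
  obtains v where "v \<in> Units (ring_mat TYPE('a) n ())" "A = B * v"
proof -
  obtain K C where KC: "finite K" "finite C" "K \<inter> C = {}" "C \<subseteq> coord_space n" "fv.independent (K \<union> C)"
    "fv.span (K \<union> C) = coord_space n" "fv.span K = mat_ker A"
    using adapted_basis_exists[OF mat_ker_subspace(1,2)[OF A]] by metis
  have KV: "K \<subseteq> coord_space n" using KC(6) fv.span_superset by blast
  have K0: "mat_app A k = 0" if "k \<in> K" for k
    using fv.span_base[OF that] KC(7) by (auto simp: mat_ker_def)
  have "\<exists>y. y \<in> coord_space n \<and> mat_app B y = mat_app A x \<and> (x \<in> K \<longrightarrow> y = x)"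
    if "x \<in> K \<union> C" for x
  proof (cases "x \<in> K")
    case True
    then have "mat_app B x = 0" using fv.span_base[OF True] KC(7) ker by (auto simp: mat_ker_def)
    then show ?thesis using True KV K0 by auto
  next
    case False
    have "mat_app A x \<in> mat_img B"
      using that KV KC(4) A unfolding img[symmetric] by (auto simp: mat_img_def)
    then show ?thesis using False B by (auto simp: mat_img_def)
  qed
  then have "\<forall>x\<in>K \<union> C. \<exists>y. y \<in> coord_space n \<and> mat_app B y = mat_app A x \<and> (x \<in> K \<longrightarrow> y = x)"
    by blast
  from bchoice[OF this] obtain g where g: "\<And>x. x \<in> K \<union> C \<Longrightarrow> g x \<in> coord_space n"
      "\<And>x. x \<in> K \<union> C \<Longrightarrow> mat_app B (g x) = mat_app A x" "\<And>x. x \<in> K \<Longrightarrow> g x = x"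
    by blast
  obtain v where v: "v \<in> carrier_mat n n" "\<And>b. b \<in> K \<union> C \<Longrightarrow> mat_app v b = g b"
    using mat_with_values_on_basis[OF KC(5,6), where g = g] g(1) by blast
  have eq: "A = B * v"
    using A B v g(2) by (intro mat_eq_on_basis[OF _ _ KC(6)]) (auto simp: mat_app_mult)
  have fix_ker: "mat_app v f = f" if "f \<in> fv.span K" for f
    using fvp.linear_eq_on[OF linear_mat_app fv.linear_id that, of v] v(2) g(3) by auto
  have "mat_ker v = {0}"
  proof -
    have "f = 0" if "f \<in> coord_space n" "mat_app v f = 0" for f
    proof -
      have "mat_app A f = 0"
        using that fvp.linear_0[OF linear_mat_app, of B] by (simp add: eq mat_app_mult[OF B v(1)])
      then have "f \<in> fv.span K" using that KC(7) A by (auto simp: mat_ker_def)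
      then show ?thesis using fix_ker that by simp
    qed
    then show ?thesis using v(1) fv.subspace_0[OF mat_ker_subspace(1)[OF v(1)]] by (auto simp: mat_ker_def)
  qed
  then have "fv.dim (mat_ker v) = 0"
    using fv.dim_eq_0_finite mat_ker_subspace[OF v(1)] by metis
  then have "fv.dim (mat_img v) = fv.dim (coord_space n :: (nat \<Rightarrow> 'a) set)"
    using rank_nullity[OF v(1)] by simp
  then have "mat_img v = coord_space n"
    using fv.subspace_eq_of_dim[OF _ subspace_coord_space finite_coord_space] mat_img_subspace[OF v(1)] by blast
  then have "v \<in> Units (ring_mat TYPE('a) n ())" by (intro img_full_imp_unit[OF v(1)]) simp
  then show ?thesis using eq that by blast
qed

text \<open>Since the kernels agree, A and B map C to two bases of the common image. The map u
  exchanges the second for the first and is the identity on a set E completing the second to a basis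
  of the whole space. Its image contains the common image and E, so u is surjective.\<close>

lemma img_ker_eq_imp_left_unit:
  fixes A B :: "'a::{field,finite} mat"
  assumes A: "A \<in> carrier_mat n n" and B: "B \<in> carrier_mat n n"
    and img: "mat_img A = mat_img B" and ker: "mat_ker A = mat_ker B"
  obtains u where "u \<in> Units (ring_mat TYPE('a) n ())" "A = u * B"
proof -
  obtain K C where KC: "finite K" "finite C" "K \<inter> C = {}" "C \<subseteq> coord_space n" "fv.independent (K \<union> C)"
    "fv.span (K \<union> C) = coord_space n" "fv.span K = mat_ker A"
    using adapted_basis_exists[OF mat_ker_subspace(1,2)[OF A]] by metis
  note adA = mat_app_adapted_basis[OF A KC(1,2,3,5,6,7)]
  note adB = mat_app_adapted_basis[OF B KC(1,2,3,5,6) KC(7)[unfolded ker]]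
  have "mat_app B ` C \<subseteq> coord_space n" using mat_app_closed[OF B] by blast
  then obtain E where E: "mat_app B ` C \<inter> E = {}" "E \<subseteq> coord_space n"
      "fv.independent (mat_app B ` C \<union> E)" "fv.span (mat_app B ` C \<union> E) = coord_space n"
    using extend_to_basis[OF adB(2)] by metis
  define g where "g y = (if y \<in> E then y else mat_app A (inv_into C (mat_app B) y))" for y
  have gE: "g y = y" if "y \<in> E" for y using that by (simp add: g_def)
  have gB: "g (mat_app B c) = mat_app A c" if "c \<in> C" for c
    using that E(1) by (auto simp: g_def inv_into_f_f[OF adB(1)])
  have "g y \<in> coord_space n" if "y \<in> mat_app B ` C \<union> E" for y
    using that E(2) mat_app_closed[OF A] by (auto simp: g_def)
  then obtain u where u: "u \<in> carrier_mat n n" "\<And>b. b \<in> mat_app B ` C \<union> E \<Longrightarrow> mat_app u b = g b"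
    using mat_with_values_on_basis[OF E(3,4), where g = g] by blast
  have eq: "A = u * B"
  proof (rule mat_eq_on_basis[OF A _ KC(6)])
    fix x assume x: "x \<in> K \<union> C"
    show "mat_app A x = mat_app (u * B) x"
    proof (cases "x \<in> K")
      case True
      then have "mat_app A x = 0" "mat_app B x = 0"
        using fv.span_base[OF True] KC(7) ker by (auto simp: mat_ker_def)
      then show ?thesis using fvp.linear_0[OF linear_mat_app, of u] by (simp add: mat_app_mult[OF u(1) B])
    next
      case False
      then show ?thesis using x u(2) gB by (simp add: mat_app_mult[OF u(1) B])
    qed
  qed (use u B in auto)
  have "mat_app A ` C \<subseteq> mat_img u"
  proof clarify
    fix c assume c: "c \<in> C"
    have "mat_app A c = mat_app u (mat_app B c)" using u(2)[of "mat_app B c"] gB[OF c] c by simp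
    then show "mat_app A c \<in> mat_img u" using mat_app_closed[OF B, of c] u(1) by (simp add: mat_img_def)
  qed
  then have "mat_img A \<subseteq> mat_img u"
    using fv.span_minimal mat_img_subspace(1)[OF u(1)] adA(3) by metis
  moreover have "mat_app B ` C \<subseteq> mat_img A" using adB(3) img fv.span_superset by metis
  moreover have "E \<subseteq> mat_img u"
  proof
    fix e assume e: "e \<in> E"
    have "e = mat_app u e" using u(2)[of e] gE[OF e] e by simp
    then show "e \<in> mat_img u" using E(2) e u(1) by (auto simp: mat_img_def)
  qed
  ultimately have "mat_app B ` C \<union> E \<subseteq> mat_img u" by (meson Un_least subset_trans)
  then have "coord_space n \<subseteq> mat_img u"
    using fv.span_minimal[OF _ mat_img_subspace(1)[OF u(1)], of "mat_app B ` C \<union> E"] E(4) by simp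
  then have "u \<in> Units (ring_mat TYPE('a) n ())" by (intro img_full_imp_unit[OF u(1)]) simp
  then show ?thesis using eq that by blast
qed

section \<open>Classes of zero divisors\<close>

text \<open>The two strict inequalities discard the zero matrix (dim U = 0) and the invertible
  matrices (dim W = 0).\<close>

definition img_ker_pairs :: "nat \<Rightarrow> ((nat \<Rightarrow> 'a::{field,finite}) set \<times> (nat \<Rightarrow> 'a) set) set" where
  "img_ker_pairs n = {(U, W). fv.subspace U \<and> U \<subseteq> coord_space n \<and> fv.subspace W \<and> W \<subseteq> coord_space n \<and>
     fv.dim U + fv.dim W = n \<and> 0 < fv.dim U \<and> 0 < fv.dim W}"

lemma finite_img_ker_pairs: "finite (img_ker_pairs n :: ((nat \<Rightarrow> 'a::{field,finite}) set \<times> _) set)"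
proof (rule finite_subset)
  show "img_ker_pairs n \<subseteq> Pow (coord_space n) \<times> (Pow (coord_space n) :: (nat \<Rightarrow> 'a) set set)"
    by (auto simp: img_ker_pairs_def)
qed (simp add: finite_coord_space)

text \<open>If a nonzero B annihilates A on either side, then ker A contains im B, or im A lies in
  ker B, which is a proper subspace; both make ker A nontrivial. Conversely, a matrix whose image
  and kernel are those of A exchanged annihilates A, and it exists because the dimensions still sum
  to n.\<close>

lemma zero_divisors_mat_iff:
  fixes A :: "'a::{field,finite} mat"
  shows "A \<in> zero_divisors (ring_mat TYPE('a) n ()) \<longleftrightarrow>
    A \<in> carrier_mat n n \<and> (mat_img A, mat_ker A) \<in> img_ker_pairs n"
proof -
  have pos: "0 < fv.dim (mat_img B) \<longleftrightarrow> B \<noteq> 0\<^sub>m n n" if "B \<in> carrier_mat n n" for B :: "'a mat"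
    using mat_img_eq_0_iff[OF that] by auto
  have Z: "A \<in> zero_divisors (ring_mat TYPE('a) n ()) \<longleftrightarrow> A \<in> carrier_mat n n \<and> A \<noteq> 0\<^sub>m n n \<and>
      (\<exists>B\<in>carrier_mat n n. B \<noteq> 0\<^sub>m n n \<and> (A * B = 0\<^sub>m n n \<or> B * A = 0\<^sub>m n n))"
    by (simp add: zero_divisors_def ring_mat_simps)
  show ?thesis
  proof
    assume "A \<in> zero_divisors (ring_mat TYPE('a) n ())"
    then obtain B where A: "A \<in> carrier_mat n n" "A \<noteq> 0\<^sub>m n n" and B: "B \<in> carrier_mat n n" "B \<noteq> 0\<^sub>m n n"
      and AB: "A * B = 0\<^sub>m n n \<or> B * A = 0\<^sub>m n n" unfolding Z by blast
    from AB have "mat_img B \<subseteq> mat_ker A \<or> mat_img A \<subseteq> mat_ker B"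
      using mult_eq_0_iff_img_ker A B by blast
    then have "fv.dim (mat_img B) \<le> fv.dim (mat_ker A) \<or> fv.dim (mat_img A) \<le> fv.dim (mat_ker B)"
      using fv.dim_mono_finite[OF mat_img_subspace(1)[OF B(1)] mat_ker_subspace(1,3)[OF A(1)]]
        fv.dim_mono_finite[OF mat_img_subspace(1)[OF A(1)] mat_ker_subspace(1,3)[OF B(1)]] by blast
    then have "0 < fv.dim (mat_ker A)"
      using pos[OF B(1)] B(2) rank_nullity[OF A(1)] rank_nullity[OF B(1)] by auto
    then show "A \<in> carrier_mat n n \<and> (mat_img A, mat_ker A) \<in> img_ker_pairs n"
      using A pos[OF A(1)] rank_nullity[OF A(1)] mat_img_subspace[OF A(1)] mat_ker_subspace[OF A(1)]
      by (simp add: img_ker_pairs_def)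
  next
    assume "A \<in> carrier_mat n n \<and> (mat_img A, mat_ker A) \<in> img_ker_pairs n"
    then have A: "A \<in> carrier_mat n n" and d: "0 < fv.dim (mat_img A)" "0 < fv.dim (mat_ker A)"
      by (auto simp: img_ker_pairs_def)
    have "img_ker_class n (mat_ker A, mat_img A) \<noteq> {}"
      using img_ker_class_nonempty[OF mat_ker_subspace(1,2)[OF A] mat_img_subspace(1,2)[OF A]]
        rank_nullity[OF A] by simp
    then obtain B where B: "B \<in> carrier_mat n n" "mat_img B = mat_ker A" "mat_ker B = mat_img A"
      by (auto simp: img_ker_class_def)
    then show "A \<in> zero_divisors (ring_mat TYPE('a) n ())"
      unfolding Z using A d pos[OF A] pos[OF B(1)] mult_eq_0_iff_img_ker[OF A B(1)] by auto
  qed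
qed

lemma img_ker_class_subset:
  "p \<in> img_ker_pairs n \<Longrightarrow> img_ker_class n p \<subseteq> zero_divisors (ring_mat TYPE('a::{field,finite}) n ())"
  by (auto simp: zero_divisors_mat_iff img_ker_class_def)

lemma img_ker_class_ne:
  assumes "p \<in> img_ker_pairs n"
  shows "img_ker_class n p \<noteq> {}"
proof -
  obtain U W where "p = (U, W)" by (cases p)
  then show ?thesis using assms img_ker_class_nonempty[of U n W] by (simp add: img_ker_pairs_def)
qed

lemma inj_on_img_ker_class:
  "inj_on (img_ker_class n) (img_ker_pairs n :: ((nat \<Rightarrow> 'a::{field,finite}) set \<times> _) set)"
proof (rule inj_onI)
  fix p p' :: "(nat \<Rightarrow> 'a) set \<times> (nat \<Rightarrow> 'a) set"
  assume p: "p \<in> img_ker_pairs n" and eq: "img_ker_class n p = img_ker_class n p'"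
  obtain A where A: "A \<in> img_ker_class n p" using img_ker_class_ne[OF p] by blast
  moreover from this have "A \<in> img_ker_class n p'" using eq by simp
  ultimately show "p = p'" by (auto simp: img_ker_class_def)
qed

lemma unit_class_mat:
  fixes A :: "'a::{field,finite} mat"
  assumes A: "A \<in> zero_divisors (ring_mat TYPE('a) n ())"
  shows "unit_class (ring_mat TYPE('a) n ()) A = img_ker_class n (mat_img A, mat_ker A)"
proof (intro Set.set_eqI iffI)
  have Ac: "A \<in> carrier_mat n n" using A by (simp add: zero_divisors_mat_iff)
  fix B
  assume "B \<in> unit_class (ring_mat TYPE('a) n ()) A"
  then obtain u v where B: "B \<in> carrier_mat n n" and u: "u \<in> Units (ring_mat TYPE('a) n ())"
    and v: "v \<in> Units (ring_mat TYPE('a) n ())" and eq: "A = u * B" "A = B * v"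
    by (auto simp: unit_class_def unit_rel_def zero_divisors_mat_iff ring_mat_simps)
  show "B \<in> img_ker_class n (mat_img A, mat_ker A)"
    using mat_img_mult_unit[OF B v] mat_ker_unit_mult[OF B u] B eq by (auto simp: img_ker_class_def)
next
  have Ac: "A \<in> carrier_mat n n" and p: "(mat_img A, mat_ker A) \<in> img_ker_pairs n"
    using A by (simp_all add: zero_divisors_mat_iff)
  fix B
  assume Bin: "B \<in> img_ker_class n (mat_img A, mat_ker A)"
  then have B: "B \<in> carrier_mat n n" "mat_img A = mat_img B" "mat_ker A = mat_ker B"
    by (auto simp: img_ker_class_def)
  have "B \<in> zero_divisors (ring_mat TYPE('a) n ())" using img_ker_class_subset[OF p] Bin by blast
  moreover obtain v where "v \<in> Units (ring_mat TYPE('a) n ())" "A = B * v"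
    by (rule img_ker_eq_imp_right_unit[OF Ac B])
  moreover obtain u where "u \<in> Units (ring_mat TYPE('a) n ())" "A = u * B"
    by (rule img_ker_eq_imp_left_unit[OF Ac B])
  ultimately have "\<exists>u\<in>Units (ring_mat TYPE('a) n ()). \<exists>v\<in>Units (ring_mat TYPE('a) n ()). A = u * B \<and> A = B * v"
    and "B \<in> zero_divisors (ring_mat TYPE('a) n ())" by blast+
  then show "B \<in> unit_class (ring_mat TYPE('a) n ()) A"
    using A by (simp add: unit_class_def unit_rel_def ring_mat_simps)
qed

text \<open>Serves to count classes: a condition on representatives that depends only on image and
  kernel becomes a condition on pairs of subspaces, and \<open>img_ker_class n\<close> is injective
  on the admissible pairs.\<close>

lemma unit_class_image:
  fixes P :: "(nat \<Rightarrow> 'a::{field,finite}) set \<times> (nat \<Rightarrow> 'a) set \<Rightarrow> bool"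
  assumes "\<And>A. A \<in> zero_divisors (ring_mat TYPE('a) n ()) \<Longrightarrow> Q A \<longleftrightarrow> P (mat_img A, mat_ker A)"
  shows "{unit_class (ring_mat TYPE('a) n ()) A | A. A \<in> zero_divisors (ring_mat TYPE('a) n ()) \<and> Q A}
    = img_ker_class n ` {p \<in> img_ker_pairs n. P p}"
proof (intro Set.set_eqI iffI)
  fix C assume "C \<in> {unit_class (ring_mat TYPE('a) n ()) A | A. A \<in> zero_divisors (ring_mat TYPE('a) n ()) \<and> Q A}"
  then obtain A where A: "C = unit_class (ring_mat TYPE('a) n ()) A" "A \<in> zero_divisors (ring_mat TYPE('a) n ())" "Q A"
    by blast
  then show "C \<in> img_ker_class n ` {p \<in> img_ker_pairs n. P p}"
    using assms[OF A(2)] by (auto simp: unit_class_mat zero_divisors_mat_iff)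
next
  fix C assume "C \<in> img_ker_class n ` {p \<in> img_ker_pairs n. P p}"
  then obtain p where p: "C = img_ker_class n p" "p \<in> img_ker_pairs n" "P p" by blast
  obtain A where A: "A \<in> img_ker_class n p" using img_ker_class_ne[OF p(2)] by blast
  then have Z: "A \<in> zero_divisors (ring_mat TYPE('a) n ())" using img_ker_class_subset[OF p(2)] by blast
  have "p = (mat_img A, mat_ker A)" using A by (auto simp: img_ker_class_def)
  then show "C \<in> {unit_class (ring_mat TYPE('a) n ()) A | A. A \<in> zero_divisors (ring_mat TYPE('a) n ()) \<and> Q A}"
    using p Z assms[OF Z] unit_class_mat[OF Z] by blast
qed

lemma quotient_unit_rel_mat:
  "zero_divisors (ring_mat TYPE('a::{field,finite}) n ()) // unit_rel (ring_mat TYPE('a) n ())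
    = img_ker_class n ` img_ker_pairs n"
proof -
  have "zero_divisors (ring_mat TYPE('a) n ()) // unit_rel (ring_mat TYPE('a) n ())
     = {unit_class (ring_mat TYPE('a) n ()) A | A. A \<in> zero_divisors (ring_mat TYPE('a) n ()) \<and> True}"
    by (auto simp: quotient_def unit_class_def)
  then show ?thesis using unit_class_image[of n "\<lambda>_. True" "\<lambda>_. True"] by simp
qed

text \<open>An idempotent fixes its image pointwise, so a vector of both U and W equals its own
  image 0. Conversely a trivial intersection makes the space the direct sum of U and W by dimension,
  and the projection to U along W lies in the class.\<close>

lemma idempotent_class_iff:
  fixes U W :: "(nat \<Rightarrow> 'a::{field,finite}) set"
  assumes p: "(U, W) \<in> img_ker_pairs n"
  shows "(\<exists>E\<in>img_ker_class n (U, W). E * E = E) \<longleftrightarrow> U \<inter> W = {0}"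
proof
  have U: "fv.subspace U" "U \<subseteq> coord_space n" and W: "fv.subspace W" "W \<subseteq> coord_space n"
    and d: "fv.dim U + fv.dim W = n"
    using p by (auto simp: img_ker_pairs_def)
  {
    assume "\<exists>E\<in>img_ker_class n (U, W). E * E = E"
    then obtain E where E: "E \<in> carrier_mat n n" "mat_img E = U" "mat_ker E = W" "E * E = E"
      by (auto simp: img_ker_class_def)
    have "x = 0" if "x \<in> U" "x \<in> W" for x
    proof -
      have "x \<in> mat_app E ` coord_space n" using that(1) E(1,2) by (auto simp: mat_img_def)
      then obtain y where "x = mat_app E y" by blast
      then have "mat_app E x = x" using mat_app_mult[OF E(1,1), of y] E(4) by simp
      then show ?thesis using that E by (auto simp: mat_ker_def)
    qed
    then show "U \<inter> W = {0}" using fv.subspace_0 U W by blast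
  next
    assume UW: "U \<inter> W = {0}"
    have fin: "finite U" "finite W" using U W finite_coord_space finite_subset by blast+
    obtain C where C: "C \<subseteq> U" "finite C" "fv.independent C" "fv.span C = U" "card C = fv.dim U"
      using fv.subspace_basis[OF U(1) fin(1) empty_subsetI fv.independent_empty] by metis
    obtain K where K: "K \<subseteq> W" "finite K" "fv.independent K" "fv.span K = W" "card K = fv.dim W"
      using fv.subspace_basis[OF W(1) fin(2) empty_subsetI fv.independent_empty] by metis
    have CK: "C \<inter> K = {}" "fv.independent (C \<union> K)"
      using fv.independent_Un_iff[OF C(2) K(2) C(3) K(3)] UW C K by auto
    have "fv.dim (fv.span (C \<union> K)) = n"
      using fv.dim_span_eq_card_independent[OF CK(2)] card_Un_disjoint[OF C(2) K(2) CK(1)] C K d by simp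
    moreover have "fv.span (C \<union> K) \<subseteq> coord_space n"
      using C K U W by (intro fv.span_minimal subspace_coord_space) blast
    ultimately have sp: "fv.span (C \<union> K) = coord_space n"
      by (intro fv.subspace_eq_of_dim[OF fv.subspace_span subspace_coord_space finite_coord_space]) auto
    define g where "g x = (if x \<in> C then x else 0)" for x
    have "g x \<in> coord_space n" for x
      using C U fv.subspace_0[OF subspace_coord_space] by (auto simp: g_def)
    then obtain E where E: "E \<in> carrier_mat n n" "\<And>b. b \<in> C \<union> K \<Longrightarrow> mat_app E b = g b"
      using mat_with_values_on_basis[OF CK(2) sp, where g = g] by blast
    have EC: "mat_app E c = c" if "c \<in> C" for c using E(2)[of c] that by (simp add: g_def)
    have EK: "mat_app E k = 0" if "k \<in> K" for k using E(2)[of k] that CK(1) by (auto simp: g_def)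
    have "C \<subseteq> mat_img E"
      using EC C U E(1) by (auto simp: mat_img_def image_iff) (metis subsetD)
    then have 1: "U \<subseteq> mat_img E" using C fv.span_minimal mat_img_subspace(1)[OF E(1)] by metis
    have "K \<subseteq> mat_ker E" using EK K W E(1) by (auto simp: mat_ker_def)
    then have 2: "W \<subseteq> mat_ker E" using K fv.span_minimal mat_ker_subspace(1)[OF E(1)] by metis
    have "E * E = E"
    proof (rule mat_eq_on_basis[OF _ _ sp])
      fix b assume "b \<in> C \<union> K"
      then show "mat_app (E * E) b = mat_app E b"
        using EC EK fvp.linear_0[OF linear_mat_app, of E] by (auto simp: mat_app_mult[OF E(1,1)])
    qed (use E in auto)
    then show "\<exists>E\<in>img_ker_class n (U, W). E * E = E"
      using mat_img_ker_eqI[OF E(1) U(1) 1 W(1) 2 d] E(1) by (auto simp: img_ker_class_def)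
  }
qed

section \<open>Counting pairs of subspaces by dimension\<close>

definition subspaces_of_dim :: "nat \<Rightarrow> nat \<Rightarrow> (nat \<Rightarrow> 'a::{field,finite}) set set" where
  "subspaces_of_dim n j = {U. fv.subspace U \<and> U \<subseteq> coord_space n \<and> fv.dim U = j}"

lemma finite_subspaces_of_dim: "finite (subspaces_of_dim n j :: (nat \<Rightarrow> 'a::{field,finite}) set set)"
proof (rule finite_subset)
  show "subspaces_of_dim n j \<subseteq> Pow (coord_space n :: (nat \<Rightarrow> 'a) set)" by (auto simp: subspaces_of_dim_def)
qed (simp add: finite_coord_space)

text \<open>The pairs are sorted by j = dim U; positivity of both dimensions is the range 1 \<le> j
  < n.\<close>

lemma card_img_ker_pairs:
  fixes P :: "(nat \<Rightarrow> 'a::{field,finite}) set \<Rightarrow> (nat \<Rightarrow> 'a) set \<Rightarrow> bool"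
  shows "card {p \<in> img_ker_pairs n. P (fst p) (snd p)}
    = (\<Sum>j=1..<n. \<Sum>U\<in>subspaces_of_dim n j. card {W \<in> subspaces_of_dim n (n - j). P U W})"
proof -
  let ?S = "\<lambda>j. SIGMA U : subspaces_of_dim n j. {W \<in> subspaces_of_dim n (n - j). P U W}"
  have "{p \<in> img_ker_pairs n. P (fst p) (snd p)} = (\<Union>j\<in>{1..<n}. ?S j)"
    by (auto simp: img_ker_pairs_def subspaces_of_dim_def)
  moreover have "card (\<Union>j\<in>{1..<n}. ?S j) = (\<Sum>j=1..<n. card (?S j))"
    by (rule card_UN_disjoint) (auto simp: finite_subspaces_of_dim, auto simp: subspaces_of_dim_def)
  moreover have "card (?S j) = (\<Sum>U\<in>subspaces_of_dim n j. card {W \<in> subspaces_of_dim n (n - j). P U W})" for j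
    by (rule card_SigmaI) (auto simp: finite_subspaces_of_dim)
  ultimately show ?thesis by simp
qed

lemma card_img_ker_pairs_Times:
  fixes P Q :: "(nat \<Rightarrow> 'a::{field,finite}) set \<Rightarrow> bool"
  shows "card {p \<in> img_ker_pairs n. P (fst p) \<and> Q (snd p)}
    = (\<Sum>j=1..<n. card {U \<in> subspaces_of_dim n j. P U} * card {W \<in> subspaces_of_dim n (n - j). Q W})"
proof -
  have "(\<Sum>U\<in>subspaces_of_dim n j. card {W \<in> subspaces_of_dim n (n - j). P U \<and> Q W})
    = card {U \<in> subspaces_of_dim n j. P U} * card {W \<in> subspaces_of_dim n (n - j). Q W}" for j
  proof -
    have "(\<Sum>U\<in>subspaces_of_dim n j. card {W \<in> subspaces_of_dim n (n - j). P U \<and> Q W})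
      = (\<Sum>U\<in>subspaces_of_dim n j. if P U then card {W \<in> subspaces_of_dim n (n - j). Q W} else 0)"
      by (rule sum.cong) auto
    then show ?thesis by (simp add: finite_subspaces_of_dim flip: sum.inter_filter)
  qed
  then show ?thesis using card_img_ker_pairs[of n "\<lambda>U W. P U \<and> Q W"] by simp
qed

lemma qbinomial_eq_0: "n < r \<Longrightarrow> qbinomial q n r = 0"
  by (auto simp: qbinomial_def)

lemma card_subspaces_below:
  fixes T :: "(nat \<Rightarrow> 'a::{field,finite}) set"
  assumes T: "fv.subspace T" "T \<subseteq> coord_space n"
  shows "real (card {U \<in> subspaces_of_dim n j. U \<subseteq> T}) = qbinomial CARD('a) (fv.dim T) j"
proof -
  have "finite T" using T finite_coord_space finite_subset by blast
  let ?Z = "{0} :: (nat \<Rightarrow> 'a) set"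
  have Z: "fv.subspace ?Z" "?Z \<subseteq> T" using fv.subspace_0 T by (auto simp: fv.subspace_single_0)
  have d: "fv.dim ?Z = 0" using fv.dim_eq_0_finite[OF Z(1)] by simp
  have "{U \<in> subspaces_of_dim n j. U \<subseteq> T} = {W. fv.subspace W \<and> ?Z \<subseteq> W \<and> W \<subseteq> T \<and> fv.dim W = fv.dim ?Z + j}"
    using T fv.subspace_0 by (auto simp: subspaces_of_dim_def d)
  then show ?thesis
    using fv.card_subspaces_between[OF Z(1) T(1) \<open>finite T\<close> Z(2), of j] d by simp
qed

lemma card_subspaces_of_dim:
  "real (card (subspaces_of_dim n j :: (nat \<Rightarrow> 'a::{field,finite}) set set)) = qbinomial CARD('a) n j"
proof -
  have "{U \<in> subspaces_of_dim n j. U \<subseteq> coord_space n} = (subspaces_of_dim n j :: (nat \<Rightarrow> 'a) set set)"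
    by (auto simp: subspaces_of_dim_def)
  then show ?thesis using card_subspaces_below[OF subspace_coord_space, of n n j, where 'a='a] by simp
qed

text \<open>The interval count gives dimension n - dim U - j inside dimension n - dim U, and
  symmetry of the q-binomial turns this into j. The cases separate where this truncated difference
  is genuine; otherwise both sides are 0.\<close>

lemma card_subspaces_above:
  fixes U :: "(nat \<Rightarrow> 'a::{field,finite}) set"
  assumes U: "fv.subspace U" "U \<subseteq> coord_space n" and j: "j \<le> n"
  shows "real (card {W \<in> subspaces_of_dim n (n - j). U \<subseteq> W}) = qbinomial CARD('a) (n - fv.dim U) j"
proof (cases "fv.dim U \<le> n - j")
  case True
  have "{W \<in> subspaces_of_dim n (n - j). U \<subseteq> W} =
      {W. fv.subspace W \<and> U \<subseteq> W \<and> W \<subseteq> coord_space n \<and> fv.dim W = fv.dim U + (n - fv.dim U - j)}"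
    using True by (auto simp: subspaces_of_dim_def)
  then have "real (card {W \<in> subspaces_of_dim n (n - j). U \<subseteq> W}) = qbinomial CARD('a) (n - fv.dim U) (n - fv.dim U - j)"
    using fv.card_subspaces_between[OF U(1) subspace_coord_space finite_coord_space U(2)] by simp
  then show ?thesis using True j qbinomial_symmetric[of j "n - fv.dim U"] finite_field_card_ge_2[where 'a='a] by simp
next
  case False
  have "{W \<in> subspaces_of_dim n (n - j). U \<subseteq> W} = {}"
    using False fv.dim_mono_finite[OF U(1)] finite_coord_space[where 'a='a] finite_subset
    by (fastforce simp: subspaces_of_dim_def)
  moreover have "n - fv.dim U < j"
    using False j fv.dim_mono_finite[OF U(1) subspace_coord_space finite_coord_space U(2)] by simp
  ultimately show ?thesis by (simp only: qbinomial_eq_0) simp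
qed

text \<open>Here (I, K) stands for A and p for B: \<open>fst p \<subseteq> K\<close> is AB = 0 and
  \<open>I \<subseteq> snd p\<close> is BA = 0. By inclusion-exclusion each condition alone
  contributes the same sum and both together the sum of squares. The pair (I, K) itself is counted
  when I \<subseteq> K, so this is not always a degree in the compressed graph.\<close>

lemma card_annihilator_pairs:
  fixes I K :: "(nat \<Rightarrow> 'a::{field,finite}) set"
  assumes p: "(I, K) \<in> img_ker_pairs n"
  defines "m \<equiv> n - fv.dim I"
  shows "real (card {p \<in> img_ker_pairs n. fst p \<subseteq> K \<or> I \<subseteq> snd p}) =
    2 * (\<Sum>j=1..m. qbinomial CARD('a) m j * qbinomial CARD('a) n j) - (\<Sum>j=1..m. (qbinomial CARD('a) m j)\<^sup>2)"
proof -
  let ?q = "CARD('a)"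
  have I: "fv.subspace I" "I \<subseteq> coord_space n" and K: "fv.subspace K" "K \<subseteq> coord_space n"
    and dK: "fv.dim K = m" and m: "m < n"
    using p by (auto simp: img_ker_pairs_def m_def)
  have sym: "qbinomial ?q n (n - j) = qbinomial ?q n j" if "j \<in> {1..<n}" for j
    using that qbinomial_symmetric[of j n] finite_field_card_ge_2[where 'a='a] by simp
  \<comment> \<open>As m = dim K is below n, cutting the range at m only drops terms with j > m,
    where the q-binomial is 0.\<close>
  have restrict: "(\<Sum>j=1..<n. qbinomial ?q m j * f j) = (\<Sum>j=1..m. qbinomial ?q m j * f j)" for f :: "nat \<Rightarrow> real"
    using m by (intro sum.mono_neutral_right) (auto simp: qbinomial_eq_0)
  have above: "real (card {W \<in> subspaces_of_dim n (n - j). I \<subseteq> W}) = qbinomial ?q m j" if "j \<in> {1..<n}" for j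
    using card_subspaces_above[OF I, of j] that by (simp add: m_def)
  let ?A = "{p \<in> img_ker_pairs n. fst p \<subseteq> K}" and ?B = "{p \<in> img_ker_pairs n. I \<subseteq> snd p}"
  have "card ?A + card ?B = card (?A \<union> ?B) + card (?A \<inter> ?B)"
    by (intro card_Un_Int finite_subset[OF _ finite_img_ker_pairs[of n]]) auto
  then have "real (card ?A) + real (card ?B) = real (card (?A \<union> ?B)) + real (card (?A \<inter> ?B))"
    by linarith
  moreover have "?A \<union> ?B = {p \<in> img_ker_pairs n. fst p \<subseteq> K \<or> I \<subseteq> snd p}"
    "?A \<inter> ?B = {p \<in> img_ker_pairs n. fst p \<subseteq> K \<and> I \<subseteq> snd p}" by auto
  moreover have "real (card ?A) = (\<Sum>j=1..<n. qbinomial ?q m j * qbinomial ?q n j)"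
    using card_img_ker_pairs_Times[of n "\<lambda>U. U \<subseteq> K" "\<lambda>_. True"]
    by (auto simp: card_subspaces_below[OF K] card_subspaces_of_dim dK sym intro!: sum.cong)
  moreover have "real (card ?B) = (\<Sum>j=1..<n. qbinomial ?q m j * qbinomial ?q n j)"
    using card_img_ker_pairs_Times[of n "\<lambda>_. True" "\<lambda>W. I \<subseteq> W"]
    by (auto simp: above card_subspaces_of_dim intro!: sum.cong)
  moreover have "real (card {p \<in> img_ker_pairs n. fst p \<subseteq> K \<and> I \<subseteq> snd p}) = (\<Sum>j=1..<n. qbinomial ?q m j * qbinomial ?q m j)"
    using card_img_ker_pairs_Times[of n "\<lambda>U. U \<subseteq> K" "\<lambda>W. I \<subseteq> W"]
    by (auto simp: card_subspaces_below[OF K] above dK intro!: sum.cong)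
  ultimately show ?thesis unfolding restrict power2_eq_square by simp
qed

text \<open>The summands for j = 0 and j = n are both 1. They belong to the idempotents 0 and 1,
  which are not zero divisors, hence the subtraction of 2.\<close>

lemma card_complementary_pairs:
  assumes "n \<ge> 1"
  shows "real (card {p \<in> img_ker_pairs n :: ((nat \<Rightarrow> 'a::{field,finite}) set \<times> _) set. fst p \<inter> snd p = {0}}) =
    (\<Sum>j=0..n. real CARD('a) ^ (j * (n - j)) * qbinomial CARD('a) n j) - 2"
proof -
  let ?q = "CARD('a)"
  have "real (card {W \<in> subspaces_of_dim n (n - j). U \<inter> W = {0}}) = real ?q ^ (j * (n - j))"
    if "j \<in> {1..<n}" "U \<in> subspaces_of_dim n j" for j and U :: "(nat \<Rightarrow> 'a) set"
  proof -
    have "{W \<in> subspaces_of_dim n (n - j). U \<inter> W = {0}} =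
        {W. fv.subspace W \<and> W \<subseteq> coord_space n \<and> fv.dim W = n - j \<and> U \<inter> W = {0}}"
      by (auto simp: subspaces_of_dim_def)
    then show ?thesis
      using that fv.card_complements[OF _ subspace_coord_space finite_coord_space, of U n "n - j"]
      by (simp add: subspaces_of_dim_def)
  qed
  then have "real (card {p \<in> img_ker_pairs n :: ((nat \<Rightarrow> 'a) set \<times> _) set. fst p \<inter> snd p = {0}})
      = (\<Sum>j=1..<n. real ?q ^ (j * (n - j)) * qbinomial ?q n j)"
    unfolding card_img_ker_pairs[of n "\<lambda>U W. U \<inter> W = {0}"] of_nat_sum
    by (intro sum.cong refl) (simp add: card_subspaces_of_dim)
  moreover have "{0..n} = insert 0 (insert n {1..<n})" using assms by auto
  moreover have "qbinomial ?q n 0 = 1" "qbinomial ?q n n = 1"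
    using finite_field_card_ge_2[where 'a='a] by (auto simp: qbinomial_def)
  ultimately show ?thesis using assms by simp
qed

text \<open>A j-dimensional U inside an (n - j)-dimensional W requires j \<le> n - j, so the
  summands beyond n div 2 vanish.\<close>

lemma card_flag_pairs:
  assumes "n \<ge> 1"
  shows "real (card {p \<in> img_ker_pairs n :: ((nat \<Rightarrow> 'a::{field,finite}) set \<times> _) set. fst p \<subseteq> snd p}) =
    (\<Sum>j=1..n div 2. qbinomial CARD('a) n j * qbinomial CARD('a) (n - j) j)"
proof -
  let ?q = "CARD('a)"
  have "real (card {W \<in> subspaces_of_dim n (n - j). U \<subseteq> W}) = qbinomial ?q (n - j) j"
    if "j \<in> {1..<n}" "U \<in> subspaces_of_dim n j" for j and U :: "(nat \<Rightarrow> 'a) set"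
    using that card_subspaces_above[of U n j] by (simp add: subspaces_of_dim_def)
  then have "real (card {p \<in> img_ker_pairs n :: ((nat \<Rightarrow> 'a) set \<times> _) set. fst p \<subseteq> snd p})
      = (\<Sum>j=1..<n. qbinomial ?q n j * qbinomial ?q (n - j) j)"
    unfolding card_img_ker_pairs[of n "\<lambda>U W. U \<subseteq> W"] of_nat_sum
    by (intro sum.cong refl) (simp add: card_subspaces_of_dim)
  also have "\<dots> = (\<Sum>j=1..n div 2. qbinomial ?q n j * qbinomial ?q (n - j) j)"
    using assms by (intro sum.mono_neutral_right) (auto simp: qbinomial_eq_0)
  finally show ?thesis .
qed

section \<open>Joins of cliques and edgeless graphs\<close>

lemma indexed_mat_cong:
  assumes "\<And>u v. u \<in> set xs \<Longrightarrow> v \<in> set xs \<Longrightarrow> f u v = f' u v"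
  shows "indexed_mat xs f = indexed_mat xs f'"
  using assms by (auto simp: indexed_mat_def intro!: eq_matI)

lemma digraph_iso_with_projI:
  assumes G: "parcs G \<subseteq> pverts G \<times> pverts G" and bij: "bij_betw g (pverts G) (pverts H)"
    and arcs: "parcs H = map_prod g g ` parcs G"
  shows "digraph_iso (with_proj G) (with_proj H)"
proof -
  let ?f = "\<lparr>iso_verts = g, iso_arcs = map_prod g g, iso_head = snd, iso_tail = fst\<rparr>"
  have inj: "inj_on g (pverts G)" using bij by (simp add: bij_betw_def)
  have "inj_on (map_prod g g) (parcs G)"
    using map_prod_inj_on[OF inj inj] G inj_on_subset by blast
  moreover have "wf_digraph (with_proj G)"
    using G by unfold_locales auto
  ultimately have "pre_digraph.digraph_isomorphism (with_proj G) ?f"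
    using inj by (auto simp: pre_digraph.digraph_isomorphism_def)
  moreover have "with_proj H = app_iso ?f (with_proj G)"
    using bij by (simp add: app_iso_def with_proj_def arcs bij_betw_def)
  ultimately show ?thesis unfolding digraph_iso_def by blast
qed

text \<open>An abstract setting for both spectra: adjacency between different classes is decided by
  \<open>H\<close>, and a class is a clique if it belongs to \<open>Q\<close> and edgeless
  otherwise. In the application \<open>Q\<close> is the set of classes with square zero.\<close>

locale clique_join =
  fixes G :: "'v pair_pre_digraph" and H :: "'i pair_pre_digraph" and cl :: "'v \<Rightarrow> 'i" and Q :: "'i set"
  assumes finite_verts: "finite (pverts G)"
    and verts_H: "pverts H = cl ` pverts G"
    and arcs_H: "parcs H \<subseteq> pverts H \<times> pverts H"
    and irrefl_H: "(C, C) \<notin> parcs H"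
    and Q_subset: "Q \<subseteq> pverts H"
    and arcs_G: "parcs G = {(u, v). u \<in> pverts G \<and> v \<in> pverts G \<and>
      (cl u = cl v \<and> u \<noteq> v \<and> cl u \<in> Q \<or> (cl u, cl v) \<in> parcs H)}"
begin

definition fiber :: "'i \<Rightarrow> 'v set" where "fiber C = {v \<in> pverts G. cl v = C}"

definition join_degree :: "'i \<Rightarrow> nat" where
  "join_degree C = (\<Sum>D | D \<in> pverts H \<and> (C, D) \<in> parcs H. card (fiber D))"

lemma finite_fiber: "finite (fiber C)"
  using finite_verts by (simp add: fiber_def)

lemma finite_verts_H: "finite (pverts H)"
  using finite_verts verts_H by simp

lemma card_fiber_pos: "C \<in> pverts H \<Longrightarrow> 0 < card (fiber C)"
  using finite_fiber[of C] by (auto simp: card_gt_0_iff fiber_def verts_H)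

text \<open>Each fibre is numbered from 0, and a vertex is sent to its class together with its
  number.\<close>

lemma iso_generalized_join:
  "digraph_iso (with_proj G) (with_proj (generalized_join H
     (\<lambda>C. if C \<in> Q then complete_graph (card (fiber C)) else null_graph (card (fiber C)))))"
    (is "digraph_iso _ (with_proj ?J)")
proof -
  have "\<exists>e. bij_betw e (fiber C) {..<card (fiber C)}" for C
    using ex_bij_betw_finite_nat[OF finite_fiber] by (simp add: lessThan_atLeast0)
  then obtain e where e: "\<And>C. bij_betw (e C) (fiber C) {..<card (fiber C)}" by metis
  define g where "g v = (cl v, e (cl v) v)" for v
  have inj_e: "e C u = e C v \<longleftrightarrow> u = v" if "u \<in> fiber C" "v \<in> fiber C" for C u v
    using e[of C] that by (auto simp: bij_betw_def inj_on_def)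
  have in_e: "e C v < card (fiber C)" if "v \<in> fiber C" for C v
    using bij_betwE[OF e[of C]] that by auto
  have verts_J: "pverts ?J = (SIGMA C : pverts H. {..<card (fiber C)})"
    by (auto simp: generalized_join_def complete_graph_def null_graph_def split: if_splits)
  have bij: "bij_betw g (pverts G) (pverts ?J)"
    unfolding bij_betw_def
  proof
    show "inj_on g (pverts G)"
    proof (rule inj_onI)
      fix u v assume uv: "u \<in> pverts G" "v \<in> pverts G" "g u = g v"
      then have cl: "cl u = cl v" and "e (cl u) u = e (cl v) v" by (auto simp: g_def)
      then have "e (cl v) u = e (cl v) v" by metis
      then show "u = v" using inj_e[of u "cl v" v] uv cl by (simp add: fiber_def)
    qed
    show "g ` pverts G = pverts ?J"
    proof (intro Set.set_eqI iffI)
      fix x assume "x \<in> g ` pverts G"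
      then show "x \<in> pverts ?J"
        unfolding verts_J using in_e by (auto simp: g_def verts_H fiber_def)
    next
      fix x assume "x \<in> pverts ?J"
      then obtain C i where x: "x = (C, i)" "C \<in> pverts H" "i < card (fiber C)"
        unfolding verts_J by blast
      then have "i \<in> e C ` fiber C" using bij_betw_imp_surj_on[OF e] by auto
      then obtain v where "v \<in> fiber C" "i = e C v" by blast
      then show "x \<in> g ` pverts G" using x by (auto simp: g_def fiber_def)
    qed
  qed
  have arc: "(g u, g v) \<in> parcs ?J \<longleftrightarrow> (u, v) \<in> parcs G" if "u \<in> pverts G" "v \<in> pverts G" for u v
  proof -
    have "cl u \<in> pverts H" "cl v \<in> pverts H" using that verts_H by auto
    then show ?thesis
      using that in_e[of u "cl u"] in_e[of v "cl v"] inj_e[of u "cl u" v]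
      by (auto simp: generalized_join_def g_def arcs_G complete_graph_def null_graph_def fiber_def)
  qed
  have "parcs ?J \<subseteq> pverts ?J \<times> pverts ?J"
    by (auto simp: generalized_join_def)
  moreover have "parcs G \<subseteq> pverts G \<times> pverts G" by (auto simp: arcs_G)
  moreover have "parcs ?J = map_prod g g ` parcs G"
  proof (intro Set.set_eqI iffI)
    fix x assume x: "x \<in> parcs ?J"
    then have "x \<in> g ` pverts G \<times> g ` pverts G"
      using \<open>parcs ?J \<subseteq> pverts ?J \<times> pverts ?J\<close> bij by (auto simp: bij_betw_def)
    then obtain u v where "x = (g u, g v)" "u \<in> pverts G" "v \<in> pverts G" by auto
    then show "x \<in> map_prod g g ` parcs G" using arc x by auto
  next
    fix x assume "x \<in> map_prod g g ` parcs G"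
    then obtain u v where "x = (g u, g v)" "(u, v) \<in> parcs G" by auto
    then show "x \<in> parcs ?J" using arc[of u v] by (auto simp: arcs_G)
  qed
  ultimately show ?thesis using bij digraph_iso_with_projI by blast
qed

text \<open>Neighbours lie in adjacent classes or, for a clique, among the other members of the own
  class; irreflexivity of \<open>H\<close> keeps the two kinds apart.\<close>

lemma out_degree_eq:
  assumes u: "u \<in> pverts G"
  shows "out_degree (with_proj G) u =
    join_degree (cl u) + (if cl u \<in> Q then card (fiber (cl u)) - 1 else 0)"
proof -
  let ?B = "\<Union>D\<in>{D. D \<in> pverts H \<and> (cl u, D) \<in> parcs H}. fiber D"
  let ?A = "if cl u \<in> Q then fiber (cl u) - {u} else {}"
  have "out_arcs (with_proj G) u = Pair u ` {v. (u, v) \<in> parcs G}"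
    by (auto simp: out_arcs_def)
  then have "out_degree (with_proj G) u = card {v. (u, v) \<in> parcs G}"
    by (simp add: out_degree_def card_image inj_on_def)
  also have "{v. (u, v) \<in> parcs G} = ?B \<union> ?A"
    using u by (auto simp: arcs_G fiber_def verts_H)
  also have "card \<dots> = card ?B + card ?A"
    using finite_verts_H finite_fiber irrefl_H
    by (intro card_Un_disjoint) (auto simp: fiber_def)
  also have "card ?B = join_degree (cl u)"
    unfolding join_degree_def using finite_verts_H finite_fiber
    by (intro card_UN_disjoint) (auto simp: fiber_def)
  also have "card ?A = (if cl u \<in> Q then card (fiber (cl u)) - 1 else 0)"
    using u by (simp add: fiber_def)
  finally show ?thesis .
qed

text \<open>This is adjacency with a loop added at each vertex of a clique class, so that it depends
  on the classes alone.\<close>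

abbreviation "adj C D \<equiv> (if C = D then if C \<in> Q then 1 else 0 else if (C, D) \<in> parcs H then 1 else 0) :: complex"

lemma sum_verts_H_split:
  fixes f :: "'i \<Rightarrow> 'c::comm_monoid_add"
  shows "sum f (pverts H) = sum f Q + sum f (pverts H - Q)"
  using sum.subset_diff[OF Q_subset finite_verts_H, of f] by (simp add: add.commute)

lemma arc_indicator:
  assumes "u \<in> pverts G" "v \<in> pverts G"
  shows "(if (u, v) \<in> parcs G then 1 else 0) = (if u = v then if cl u \<in> Q then - 1 else 0 else 0) + adj (cl u) (cl v)"
  using assms irrefl_H by (auto simp: arcs_G)

lemma adjacency_spectrum:
  assumes vs: "distinct vs" "set vs = pverts G" and cs: "distinct cs" "set cs = pverts H"
  shows "eigenvalue_mset (adjacency_mat G vs) =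
    (\<Sum>C\<in>Q. replicate_mset (card (fiber C) - 1) (- 1))
    + (\<Sum>C\<in>pverts H - Q. replicate_mset (card (fiber C) - 1) 0)
    + eigenvalue_mset (indexed_mat cs (\<lambda>C D.
        if C = D then (if C \<in> Q then of_nat (card (fiber C)) - 1 else 0)
        else if (C, D) \<in> parcs H then complex_of_real (sqrt (real (card (fiber C)) * real (card (fiber D))))
        else 0))"
proof -
  define a :: "'i \<Rightarrow> complex" where "a C = (if C \<in> Q then - 1 else 0)" for C
  have img: "set cs = cl ` set vs" using vs cs verts_H by simp
  have "adjacency_mat G vs = indexed_mat vs (\<lambda>u v. (if u = v then a (cl u) else 0) + adj (cl u) (cl v))"
    unfolding adjacency_mat_def a_def using vs by (intro indexed_mat_cong arc_indicator) auto
  then have "eigenvalue_mset (adjacency_mat G vs) =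
      (\<Sum>C\<in>pverts H. replicate_mset (card (fiber C) - 1) (a C)) +
      eigenvalue_mset (indexed_mat cs (\<lambda>C D. (if C = D then a C else 0) +
        complex_of_real (sqrt (real (card (fiber C)) * real (card (fiber D)))) * adj C D))"
    using eigenvalue_mset_blowup[OF vs(1) cs(1) img, of a "\<lambda>C D. adj C D"] vs cs by (simp add: fiber_def)
  also have "(\<Sum>C\<in>pverts H. replicate_mset (card (fiber C) - 1) (a C)) =
      (\<Sum>C\<in>Q. replicate_mset (card (fiber C) - 1) (- 1))
      + (\<Sum>C\<in>pverts H - Q. replicate_mset (card (fiber C) - 1) 0)"
    unfolding sum_verts_H_split by (intro arg_cong2[of _ _ _ _ "(+)"] sum.cong) (auto simp: a_def)
  \<comment> \<open>On the diagonal the square root is the class size n_C, so a clique class gets -1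
    + n_C.\<close>
  also have "indexed_mat cs (\<lambda>C D. (if C = D then a C else 0) +
        complex_of_real (sqrt (real (card (fiber C)) * real (card (fiber D)))) * adj C D)
    = indexed_mat cs (\<lambda>C D.
        if C = D then (if C \<in> Q then of_nat (card (fiber C)) - 1 else 0)
        else if (C, D) \<in> parcs H then complex_of_real (sqrt (real (card (fiber C)) * real (card (fiber D))))
        else 0)"
    by (intro indexed_mat_cong) (auto simp: a_def)
  finally show ?thesis .
qed

lemma laplacian_spectrum:
  assumes vs: "distinct vs" "set vs = pverts G" and cs: "distinct cs" "set cs = pverts H"
  shows "eigenvalue_mset (laplacian_mat G vs) =
    (\<Sum>C\<in>Q. replicate_mset (card (fiber C) - 1) (of_nat (join_degree C + card (fiber C))))
    + (\<Sum>C\<in>pverts H - Q. replicate_mset (card (fiber C) - 1) (of_nat (join_degree C)))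
    + eigenvalue_mset (indexed_mat cs (\<lambda>C D.
        if C = D then of_nat (join_degree C)
        else if (C, D) \<in> parcs H then - complex_of_real (sqrt (real (card (fiber C)) * real (card (fiber D))))
        else 0))"
proof -
  \<comment> \<open>In a clique class the degree is
    \<open>join_degree C + card (fiber C) - 1\<close>; compensating the loop in \<open>- adj\<close>
    adds 1.\<close>
  define a :: "'i \<Rightarrow> complex" where
    "a C = of_nat (join_degree C + (if C \<in> Q then card (fiber C) else 0))" for C
  have img: "set cs = cl ` set vs" using vs cs verts_H by simp
  have entry: "(if u = v then of_nat (out_degree (with_proj G) u) else 0) - (if (u, v) \<in> parcs G then 1 else 0)
      = (if u = v then a (cl u) else 0) + - adj (cl u) (cl v)"
    if uv: "u \<in> pverts G" "v \<in> pverts G" for u v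
  proof (cases "u = v")
    case True
    have "0 < card (fiber (cl u))" using card_fiber_pos uv verts_H by blast
    then show ?thesis
      using True irrefl_H uv by (auto simp: arcs_G a_def out_degree_eq of_nat_diff)
  next
    case False
    then show ?thesis using arc_indicator[OF uv] by simp
  qed
  have "laplacian_mat G vs = indexed_mat vs (\<lambda>u v.
      (if u = v then of_nat (out_degree (with_proj G) u) else 0) - (if (u, v) \<in> parcs G then 1 else 0))"
    by (auto simp: laplacian_mat_def adjacency_mat_def indexed_mat_def intro!: eq_matI)
  also have "\<dots> = indexed_mat vs (\<lambda>u v. (if u = v then a (cl u) else 0) + - adj (cl u) (cl v))"
    using vs by (intro indexed_mat_cong entry) auto
  finally have "eigenvalue_mset (laplacian_mat G vs) =
      (\<Sum>C\<in>pverts H. replicate_mset (card (fiber C) - 1) (a C)) +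
      eigenvalue_mset (indexed_mat cs (\<lambda>C D. (if C = D then a C else 0) +
        complex_of_real (sqrt (real (card (fiber C)) * real (card (fiber D)))) * - adj C D))"
    using eigenvalue_mset_blowup[OF vs(1) cs(1) img, of a "\<lambda>C D. - adj C D"] vs cs by (simp add: fiber_def)
  also have "(\<Sum>C\<in>pverts H. replicate_mset (card (fiber C) - 1) (a C)) =
      (\<Sum>C\<in>Q. replicate_mset (card (fiber C) - 1) (of_nat (join_degree C + card (fiber C))))
      + (\<Sum>C\<in>pverts H - Q. replicate_mset (card (fiber C) - 1) (of_nat (join_degree C)))"
    unfolding sum_verts_H_split by (intro arg_cong2[of _ _ _ _ "(+)"] sum.cong) (auto simp: a_def)
  \<comment> \<open>In a clique class the added \<open>card (fiber C)\<close> cancels against the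
    diagonal of \<open>- adj\<close>, so both kinds of classes end with \<open>join_degree C\<close>
    on the diagonal.\<close>
  also have "indexed_mat cs (\<lambda>C D. (if C = D then a C else 0) +
        complex_of_real (sqrt (real (card (fiber C)) * real (card (fiber D)))) * - adj C D)
    = indexed_mat cs (\<lambda>C D.
        if C = D then of_nat (join_degree C)
        else if (C, D) \<in> parcs H then - complex_of_real (sqrt (real (card (fiber C)) * real (card (fiber D))))
        else 0)"
    by (intro indexed_mat_cong) (auto simp: a_def)
  finally show ?thesis .
qed

end

section \<open>The zero-divisor graph of a matrix ring\<close>

text \<open>The set is covered by finitely many classes, and each of these is finite because its
  cardinality was computed to be nonzero.\<close>

lemma finite_zero_divisors_mat: "finite (zero_divisors (ring_mat TYPE('a::{field,finite}) n ()))"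
proof (rule finite_subset)
  show "zero_divisors (ring_mat TYPE('a) n ()) \<subseteq> (\<Union>p\<in>img_ker_pairs n. img_ker_class n p)"
    by (auto simp: zero_divisors_mat_iff img_ker_class_def)
  have "finite (img_ker_class n (U, W))" if "(U, W) \<in> img_ker_pairs n" for U W :: "(nat \<Rightarrow> 'a) set"
  proof -
    have "(\<Prod>i<fv.dim U. real CARD('a) ^ fv.dim U - real CARD('a) ^ i) \<noteq> 0"
      using finite_field_card_ge_2[where 'a='a] by auto
    moreover have "real (card (img_ker_class n (U, W))) =
        (\<Prod>i<fv.dim U. real CARD('a) ^ fv.dim U - real CARD('a) ^ i)"
      using that by (intro card_img_ker_class) (auto simp: img_ker_pairs_def)
    ultimately have "card (img_ker_class n (U, W)) \<noteq> 0" by (metis of_nat_0)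
    then have "0 < card (img_ker_class n (U, W))" by simp
    then show ?thesis using card_ge_0_finite by blast
  qed
  then show "finite (\<Union>p\<in>img_ker_pairs n. img_ker_class n p :: 'a mat set)"
    by (intro finite_UN_I finite_img_ker_pairs) auto
qed

lemma generalized_join_cong:
  assumes "\<And>i. i \<in> pverts H \<Longrightarrow> G i = G' i"
  shows "generalized_join H G = generalized_join H G'"
proof -
  have "(SIGMA i : pverts H. pverts (G i)) = (SIGMA i : pverts H. pverts (G' i))"
    using assms by (intro Sigma_cong) auto
  moreover have "i \<in> pverts H \<and> j \<in> pverts H \<and> u \<in> pverts (G i) \<and> v \<in> pverts (G j) \<and>
      (i = j \<and> (u, v) \<in> parcs (G i) \<or> (i, j) \<in> parcs H) \<longleftrightarrow>
    i \<in> pverts H \<and> j \<in> pverts H \<and> u \<in> pverts (G' i) \<and> v \<in> pverts (G' j) \<and>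
      (i = j \<and> (u, v) \<in> parcs (G' i) \<or> (i, j) \<in> parcs H)" for i u j v
    using assms[of i] assms[of j] by auto
  ultimately show ?thesis unfolding generalized_join_def by (simp only:)
qed

lemma unit_class_mat_eq_iff:
  fixes A B :: "'a::{field,finite} mat"
  assumes "A \<in> zero_divisors (ring_mat TYPE('a) n ())" "B \<in> zero_divisors (ring_mat TYPE('a) n ())"
  shows "unit_class (ring_mat TYPE('a) n ()) A = unit_class (ring_mat TYPE('a) n ()) B \<longleftrightarrow>
    mat_img A = mat_img B \<and> mat_ker A = mat_ker B"
  using assms inj_on_eq_iff[OF inj_on_img_ker_class[of n], of "(mat_img A, mat_ker A)" "(mat_img B, mat_ker B)"]
  by (simp add: unit_class_mat zero_divisors_mat_iff)

lemma zero_divisor_mult_eq_0_iff: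
  fixes A B :: "'a::{field,finite} mat"
  assumes "A \<in> zero_divisors (ring_mat TYPE('a) n ())" "B \<in> zero_divisors (ring_mat TYPE('a) n ())"
  shows "A \<otimes>\<^bsub>ring_mat TYPE('a) n ()\<^esub> B = \<zero>\<^bsub>ring_mat TYPE('a) n ()\<^esub> \<longleftrightarrow> mat_img B \<subseteq> mat_ker A"
  using assms mult_eq_0_iff_img_ker[of A n B] by (simp add: zero_divisors_mat_iff ring_mat_simps)

text \<open>The set on the left only provides some representative B with square zero; since B shares
  image and kernel with A, the condition can be stated for A itself.\<close>

lemma unit_class_in_nilpotent_classes_iff:
  fixes A :: "'a::{field,finite} mat" and n :: nat
  defines "R \<equiv> ring_mat TYPE('a) n ()"
  assumes A: "A \<in> zero_divisors R"
  shows "unit_class R A \<in> {unit_class R B | B. B \<in> zero_divisors R \<and> B \<noteq> \<zero>\<^bsub>R\<^esub> \<and> B \<otimes>\<^bsub>R\<^esub> B = \<zero>\<^bsub>R\<^esub>} \<longleftrightarrow>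
    mat_img A \<subseteq> mat_ker A"
proof
  assume "unit_class R A \<in> {unit_class R B | B. B \<in> zero_divisors R \<and> B \<noteq> \<zero>\<^bsub>R\<^esub> \<and> B \<otimes>\<^bsub>R\<^esub> B = \<zero>\<^bsub>R\<^esub>}"
  then obtain B where B: "unit_class R A = unit_class R B" "B \<in> zero_divisors R" "B \<otimes>\<^bsub>R\<^esub> B = \<zero>\<^bsub>R\<^esub>" by blast
  then show "mat_img A \<subseteq> mat_ker A"
    using unit_class_mat_eq_iff[of A n B] zero_divisor_mult_eq_0_iff[of B n B] A by (simp add: R_def)
next
  assume "mat_img A \<subseteq> mat_ker A"
  then have "A \<otimes>\<^bsub>R\<^esub> A = \<zero>\<^bsub>R\<^esub>"
    using zero_divisor_mult_eq_0_iff[of A n A] A by (simp add: R_def)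
  moreover have "A \<noteq> \<zero>\<^bsub>R\<^esub>" using A by (simp add: zero_divisors_def)
  ultimately show "unit_class R A \<in> {unit_class R B | B. B \<in> zero_divisors R \<and> B \<noteq> \<zero>\<^bsub>R\<^esub> \<and> B \<otimes>\<^bsub>R\<^esub> B = \<zero>\<^bsub>R\<^esub>}"
    using A by blast
qed

lemma unit_class_arc_iff:
  fixes A B :: "'a::{field,finite} mat" and n :: nat
  defines "R \<equiv> ring_mat TYPE('a) n ()"
  assumes A: "A \<in> zero_divisors R" and B: "B \<in> zero_divisors R"
  shows "(unit_class R A, unit_class R B) \<in> parcs (compressed_graph R) \<longleftrightarrow>
    unit_class R A \<noteq> unit_class R B \<and> (mat_img B \<subseteq> mat_ker A \<or> mat_img A \<subseteq> mat_ker B)"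
proof
  assume "(unit_class R A, unit_class R B) \<in> parcs (compressed_graph R)"
  then obtain A' B' where *: "A' \<in> zero_divisors R" "B' \<in> zero_divisors R" "unit_class R A' \<noteq> unit_class R B'"
    "A' \<otimes>\<^bsub>R\<^esub> B' = \<zero>\<^bsub>R\<^esub> \<or> B' \<otimes>\<^bsub>R\<^esub> A' = \<zero>\<^bsub>R\<^esub>" "unit_class R A = unit_class R A'" "unit_class R B = unit_class R B'"
    by (auto simp: compressed_graph_def)
  then show "unit_class R A \<noteq> unit_class R B \<and> (mat_img B \<subseteq> mat_ker A \<or> mat_img A \<subseteq> mat_ker B)"
    using unit_class_mat_eq_iff[of A n A'] unit_class_mat_eq_iff[of B n B']
      zero_divisor_mult_eq_0_iff[of A' n B'] zero_divisor_mult_eq_0_iff[of B' n A'] A B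
    by (simp add: R_def)
next
  assume "unit_class R A \<noteq> unit_class R B \<and> (mat_img B \<subseteq> mat_ker A \<or> mat_img A \<subseteq> mat_ker B)"
  then show "(unit_class R A, unit_class R B) \<in> parcs (compressed_graph R)"
    using zero_divisor_mult_eq_0_iff[of A n B] zero_divisor_mult_eq_0_iff[of B n A] A B
    unfolding compressed_graph_def R_def by auto
qed

text \<open>Members u and v of one class have the same image and kernel, so uv = 0 says that this
  image lies in this kernel: the class is a clique if its square is zero and edgeless otherwise. For
  different classes, vanishing of a product depends only on the two pairs.\<close>

lemma clique_join_zero_divisor_graph:
  fixes n :: nat
  defines "R \<equiv> ring_mat TYPE('a::{field,finite}) n ()"
  shows "clique_join (zero_divisor_graph R) (compressed_graph R) (unit_class R)
    {unit_class R A | A. A \<in> zero_divisors R \<and> A \<noteq> \<zero>\<^bsub>R\<^esub> \<and> A \<otimes>\<^bsub>R\<^esub> A = \<zero>\<^bsub>R\<^esub>}"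
    (is "clique_join ?G ?H ?cl ?Q")
proof
  have verts: "pverts ?G = zero_divisors R" by (simp add: zero_divisor_graph_def)
  show "finite (pverts ?G)" by (subst verts) (simp add: R_def finite_zero_divisors_mat)
  show vH: "pverts ?H = ?cl ` pverts ?G"
    by (auto simp: compressed_graph_def verts quotient_def unit_class_def)
  show "parcs ?H \<subseteq> pverts ?H \<times> pverts ?H"
    unfolding vH verts by (auto simp: compressed_graph_def)
  show "(C, C) \<notin> parcs ?H" for C by (auto simp: compressed_graph_def)
  show "?Q \<subseteq> pverts ?H" unfolding vH verts by auto
  show "parcs ?G = {(u, v). u \<in> pverts ?G \<and> v \<in> pverts ?G \<and>
      (?cl u = ?cl v \<and> u \<noteq> v \<and> ?cl u \<in> ?Q \<or> (?cl u, ?cl v) \<in> parcs ?H)}"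
  proof -
    have "u \<noteq> v \<and> (u \<otimes>\<^bsub>R\<^esub> v = \<zero>\<^bsub>R\<^esub> \<or> v \<otimes>\<^bsub>R\<^esub> u = \<zero>\<^bsub>R\<^esub>) \<longleftrightarrow>
        ?cl u = ?cl v \<and> u \<noteq> v \<and> ?cl u \<in> ?Q \<or> (?cl u, ?cl v) \<in> parcs ?H"
      if uv: "u \<in> zero_divisors R" "v \<in> zero_divisors R" for u v
    proof -
      note z = uv[unfolded R_def]
      have uv0: "u \<otimes>\<^bsub>R\<^esub> v = \<zero>\<^bsub>R\<^esub> \<longleftrightarrow> mat_img v \<subseteq> mat_ker u"
        and vu0: "v \<otimes>\<^bsub>R\<^esub> u = \<zero>\<^bsub>R\<^esub> \<longleftrightarrow> mat_img u \<subseteq> mat_ker v"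
        using zero_divisor_mult_eq_0_iff[OF z] zero_divisor_mult_eq_0_iff[OF z(2,1)] by (simp_all add: R_def)
      have Q: "?cl u \<in> ?Q \<longleftrightarrow> mat_img u \<subseteq> mat_ker u"
        using unit_class_in_nilpotent_classes_iff[OF z(1)] by (simp only: R_def)
      have arc: "(?cl u, ?cl v) \<in> parcs ?H \<longleftrightarrow> ?cl u \<noteq> ?cl v \<and> (mat_img v \<subseteq> mat_ker u \<or> mat_img u \<subseteq> mat_ker v)"
        using unit_class_arc_iff[OF z] by (simp only: R_def)
      have "?cl u = ?cl v \<longleftrightarrow> mat_img u = mat_img v \<and> mat_ker u = mat_ker v"
        using unit_class_mat_eq_iff[OF z] by (simp only: R_def)
      then show ?thesis unfolding uv0 vu0 Q arc by (cases "?cl u = ?cl v") auto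
    qed
    then show ?thesis unfolding verts by (auto simp: zero_divisor_graph_def)
  qed
qed

theorem theorem3p16:
  fixes p k q n :: nat
  assumes "prime p" and "q = p ^ k" and "CARD('a::{field, finite}) = q" and "n \<ge> 1"
  defines "R \<equiv> ring_mat TYPE('a) n ()"
  defines "\<Gamma> \<equiv> zero_divisor_graph R"
  defines "H \<equiv> compressed_graph R"
  defines "X \<equiv> zero_divisors R // unit_rel R"
  defines "X2 \<equiv> {unit_class R A | A. A \<in> zero_divisors R \<and> A \<noteq> \<zero>\<^bsub>R\<^esub> \<and> A \<otimes>\<^bsub>R\<^esub> A = \<zero>\<^bsub>R\<^esub>}"
  defines "Y2 \<equiv> {C \<in> X. \<exists>E \<in> C. E \<otimes>\<^bsub>R\<^esub> E = E}"
  defines "N \<equiv> (\<lambda>C. \<Sum>D | D \<in> X \<and> (C, D) \<in> parcs H. card D)"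
  defines "C_A \<equiv> (\<lambda>C D.
      if C = D then (if C \<in> X2 then of_nat (card C) - 1 else 0)
      else if (C, D) \<in> parcs H then complex_of_real (sqrt (real (card C) * real (card D)))
      else 0)"
  defines "C_N \<equiv> (\<lambda>C D.
      if C = D then of_nat (N C)
      else if (C, D) \<in> parcs H then - complex_of_real (sqrt (real (card C) * real (card D)))
      else 0)"
  shows
    "(\<forall>A \<in> zero_divisors R. let r = vec_space.rank n A in
        real (card (unit_class R A)) = (\<Prod>j<r. real q ^ r - real q ^ j) \<and>
        real (card {unit_class R B | B. B \<in> zero_divisors R \<and>
                      (A \<otimes>\<^bsub>R\<^esub> B = \<zero>\<^bsub>R\<^esub> \<or> B \<otimes>\<^bsub>R\<^esub> A = \<zero>\<^bsub>R\<^esub>)}) =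
          2 * (\<Sum>j=1..n-r. qbinomial q (n - r) j * qbinomial q n j)
            - (\<Sum>j=1..n-r. (qbinomial q (n - r) j)\<^sup>2))
     \<and> real (card Y2) = (\<Sum>j=0..n. real q ^ (j * (n - j)) * qbinomial q n j) - 2
     \<and> real (card X2) = (\<Sum>j=1..n div 2. qbinomial q n j * qbinomial q (n - j) j)
     \<and> digraph_iso (with_proj \<Gamma>) (with_proj (generalized_join H
          (\<lambda>C. if C \<in> X2 then complete_graph (card C) else null_graph (card C))))
     \<and> (\<forall>vs cs. distinct vs \<and> set vs = zero_divisors R \<and> distinct cs \<and> set cs = X \<longrightarrow>
          eigenvalue_mset (adjacency_mat \<Gamma> vs) =
            (\<Sum>C\<in>X2. replicate_mset (card C - 1) (- 1))
            + (\<Sum>C\<in>X - X2. replicate_mset (card C - 1) 0)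
            + eigenvalue_mset (indexed_mat cs C_A)
          \<and> eigenvalue_mset (laplacian_mat \<Gamma> vs) =
            (\<Sum>C\<in>X2. replicate_mset (card C - 1) (of_nat (N C + card C)))
            + (\<Sum>C\<in>X - X2. replicate_mset (card C - 1) (of_nat (N C)))
            + eigenvalue_mset (indexed_mat cs C_N))"
proof -
  let ?cl = "unit_class R"
  have q: "q = CARD('a)" using assms(3) by simp
  interpret J: clique_join \<Gamma> H ?cl X2
    unfolding \<Gamma>_def H_def X2_def R_def by (rule clique_join_zero_divisor_graph)
  have vG: "pverts \<Gamma> = zero_divisors R" by (simp add: \<Gamma>_def zero_divisor_graph_def)
  have vH: "pverts H = X" by (simp add: H_def X_def compressed_graph_def)
  \<comment> \<open>A class is the fibre of the class map over itself, so the fibre sizes in the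
    abstract setting are the numbers n_i.\<close>
  have fiber: "J.fiber C = C" if "C \<in> X" for C
  proof -
    have "C \<in> ?cl ` zero_divisors R" using that vH J.verts_H vG by simp
    then obtain A where A: "A \<in> zero_divisors R" "C = ?cl A" by blast
    have "B \<in> C \<longleftrightarrow> B \<in> zero_divisors R \<and> ?cl B = C" for B
    proof -
      have "C = img_ker_class n (mat_img A, mat_ker A)" "(mat_img A, mat_ker A) \<in> img_ker_pairs n"
        using A unit_class_mat[of A n] by (simp_all add: R_def zero_divisors_mat_iff)
      then show ?thesis
        using A unit_class_mat_eq_iff[of B n A] img_ker_class_subset[of "(mat_img A, mat_ker A)" n]
        by (auto simp: R_def img_ker_class_def zero_divisors_mat_iff)
    qed
    then show ?thesis unfolding J.fiber_def vG by blast
  qed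
  have X2X: "X2 \<subseteq> X" using J.Q_subset vH by simp
  have N: "J.join_degree C = N C" for C
    unfolding J.join_degree_def N_def vH by (rule sum.cong) (auto simp: fiber)
  have part1: "let r = vec_space.rank n A in
        real (card (unit_class R A)) = (\<Prod>j<r. real q ^ r - real q ^ j) \<and>
        real (card {unit_class R B | B. B \<in> zero_divisors R \<and>
                      (A \<otimes>\<^bsub>R\<^esub> B = \<zero>\<^bsub>R\<^esub> \<or> B \<otimes>\<^bsub>R\<^esub> A = \<zero>\<^bsub>R\<^esub>)}) =
          2 * (\<Sum>j=1..n-r. qbinomial q (n - r) j * qbinomial q n j)
            - (\<Sum>j=1..n-r. (qbinomial q (n - r) j)\<^sup>2)"
    if A: "A \<in> zero_divisors R" for A
  proof -
    have Ac: "A \<in> carrier_mat n n" and p: "(mat_img A, mat_ker A) \<in> img_ker_pairs n"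
      using A by (simp_all add: R_def zero_divisors_mat_iff)
    have r: "vec_space.rank n A = fv.dim (mat_img A)" by (rule rank_eq_dim_img[OF Ac])
    have "real (card (unit_class R A)) = (\<Prod>j<fv.dim (mat_img A). real q ^ fv.dim (mat_img A) - real q ^ j)"
      using A p card_img_ker_class[of "mat_img A" n "mat_ker A"] unit_class_mat[of A n]
      by (simp add: R_def q img_ker_pairs_def)
    moreover have "{unit_class R B | B. B \<in> zero_divisors R \<and>
          (A \<otimes>\<^bsub>R\<^esub> B = \<zero>\<^bsub>R\<^esub> \<or> B \<otimes>\<^bsub>R\<^esub> A = \<zero>\<^bsub>R\<^esub>)} =
        img_ker_class n ` {p \<in> img_ker_pairs n. fst p \<subseteq> mat_ker A \<or> mat_img A \<subseteq> snd p}"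
      unfolding R_def using A zero_divisor_mult_eq_0_iff[of A n] zero_divisor_mult_eq_0_iff[of _ n A]
      by (intro unit_class_image) (simp add: R_def)
    then have "card {unit_class R B | B. B \<in> zero_divisors R \<and>
          (A \<otimes>\<^bsub>R\<^esub> B = \<zero>\<^bsub>R\<^esub> \<or> B \<otimes>\<^bsub>R\<^esub> A = \<zero>\<^bsub>R\<^esub>)} =
        card {p \<in> img_ker_pairs n. fst p \<subseteq> mat_ker A \<or> mat_img A \<subseteq> snd p}"
      using card_image[OF inj_on_subset[OF inj_on_img_ker_class[of n],
        of "{p \<in> img_ker_pairs n. fst p \<subseteq> mat_ker A \<or> mat_img A \<subseteq> snd p}"]] by auto
    ultimately show ?thesis
      unfolding Let_def r using card_annihilator_pairs[OF p] by (simp add: q)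
  qed
  have part2: "real (card Y2) = (\<Sum>j=0..n. real q ^ (j * (n - j)) * qbinomial q n j) - 2"
  proof -
    have "Y2 = img_ker_class n ` {p \<in> img_ker_pairs n. fst p \<inter> snd p = {0}}"
      unfolding Y2_def X_def R_def quotient_unit_rel_mat
      using idempotent_class_iff by (fastforce simp: ring_mat_simps)
    then have "card Y2 = card {p \<in> img_ker_pairs n :: ((nat \<Rightarrow> 'a) set \<times> _) set. fst p \<inter> snd p = {0}}"
      using card_image[OF inj_on_subset[OF inj_on_img_ker_class[of n],
        of "{p \<in> img_ker_pairs n :: ((nat \<Rightarrow> 'a) set \<times> _) set. fst p \<inter> snd p = {0}}"]] by auto
    then show ?thesis using card_complementary_pairs[OF assms(4), where 'a='a] by (simp add: q)
  qed
  have part3: "real (card X2) = (\<Sum>j=1..n div 2. qbinomial q n j * qbinomial q (n - j) j)"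
  proof -
    have "X2 = {unit_class R A | A. A \<in> zero_divisors R \<and> A \<otimes>\<^bsub>R\<^esub> A = \<zero>\<^bsub>R\<^esub>}"
      by (auto simp: X2_def zero_divisors_def)
    also have "\<dots> = img_ker_class n ` {p \<in> img_ker_pairs n. fst p \<subseteq> snd p}"
      unfolding R_def by (intro unit_class_image) (simp add: zero_divisor_mult_eq_0_iff)
    finally have "card X2 = card {p \<in> img_ker_pairs n :: ((nat \<Rightarrow> 'a) set \<times> _) set. fst p \<subseteq> snd p}"
      using card_image[OF inj_on_subset[OF inj_on_img_ker_class[of n],
        of "{p \<in> img_ker_pairs n :: ((nat \<Rightarrow> 'a) set \<times> _) set. fst p \<subseteq> snd p}"]] by auto
    then show ?thesis using card_flag_pairs[OF assms(4), where 'a='a] by (simp add: q)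
  qed
  have part4: "digraph_iso (with_proj \<Gamma>) (with_proj (generalized_join H
          (\<lambda>C. if C \<in> X2 then complete_graph (card C) else null_graph (card C))))"
  proof -
    have "generalized_join H (\<lambda>C. if C \<in> X2 then complete_graph (card (J.fiber C)) else null_graph (card (J.fiber C)))
      = generalized_join H (\<lambda>C. if C \<in> X2 then complete_graph (card C) else null_graph (card C))"
      by (rule generalized_join_cong) (simp add: vH fiber)
    then show ?thesis using J.iso_generalized_join by simp
  qed
  have part5: "eigenvalue_mset (adjacency_mat \<Gamma> vs) =
            (\<Sum>C\<in>X2. replicate_mset (card C - 1) (- 1))
            + (\<Sum>C\<in>X - X2. replicate_mset (card C - 1) 0)
            + eigenvalue_mset (indexed_mat cs C_A)
          \<and> eigenvalue_mset (laplacian_mat \<Gamma> vs) =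
            (\<Sum>C\<in>X2. replicate_mset (card C - 1) (of_nat (N C + card C)))
            + (\<Sum>C\<in>X - X2. replicate_mset (card C - 1) (of_nat (N C)))
            + eigenvalue_mset (indexed_mat cs C_N)"
    if vs: "distinct vs" "set vs = zero_divisors R" and cs: "distinct cs" "set cs = X" for vs cs
  proof -
    \<comment> \<open>Stated for a general eigenvalue g, so that one fact converts fibre sizes to
      class sizes in all four multiset sums.\<close>
    have f: "(\<Sum>C\<in>S. replicate_mset (card (J.fiber C) - 1) (g (card (J.fiber C)) C)) =
        (\<Sum>C\<in>S. replicate_mset (card C - 1) (g (card C) C))" if "S \<subseteq> X"
      for S and g :: "nat \<Rightarrow> 'a mat set \<Rightarrow> complex"
      using that fiber by (intro sum.cong) auto
    have A: "indexed_mat cs C_A = indexed_mat cs (\<lambda>C D.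
        if C = D then (if C \<in> X2 then of_nat (card (J.fiber C)) - 1 else 0)
        else if (C, D) \<in> parcs H then complex_of_real (sqrt (real (card (J.fiber C)) * real (card (J.fiber D))))
        else 0)"
      using cs fiber by (intro indexed_mat_cong) (simp add: C_A_def)
    have L: "indexed_mat cs C_N = indexed_mat cs (\<lambda>C D.
        if C = D then of_nat (J.join_degree C)
        else if (C, D) \<in> parcs H then - complex_of_real (sqrt (real (card (J.fiber C)) * real (card (J.fiber D))))
        else 0)"
      using cs fiber by (intro indexed_mat_cong) (simp add: C_N_def N)
    have vs': "set vs = pverts \<Gamma>" and cs': "set cs = pverts H" using vs cs vG vH by auto
    show ?thesis
      unfolding A L J.adjacency_spectrum[OF vs(1) vs' cs(1) cs'] J.laplacian_spectrum[OF vs(1) vs' cs(1) cs'] vH N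
      using f[OF X2X, of "\<lambda>_ _. - 1"] f[of "X - X2" "\<lambda>_ _. 0"]
        f[OF X2X, of "\<lambda>m C. of_nat (N C + m)"] f[of "X - X2" "\<lambda>_ C. of_nat (N C)"]
      by simp
  qed
  show ?thesis using part1 part2 part3 part4 part5 by blast
qed

end
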